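(* Let $\Sigma$ be given in a special coordinate basis (SCB) as in the context, strongly detectable (so $n_c=0$ and $A_a$ is Hurwitz), with $F_{dd}$ having the lower-block-triangular structure described in the context. Assume the unknown input satisfies $|u_{d,i}(t)|\le\Delta_{d,i}$ for all $t\ge0$ and $i=1,\dots,m_d$, for known constants $\Delta_{d,i}\ge 0$. Let $L_b$ be such that $A_b-L_bC_b$ is Hurwitz, and let $\hat x_a,\hat x_b$ be generated by $\dot{\hat x}_a=A_a\hat x_a+H_{ab}y_b+H_{ad}y_d+B_{0a}y_0$, $\dot{\hat x}_b=A_b\hat x_b+H_{bd}y_d+B_{0b}y_0+L_b(y_b-C_b\hat x_b)$. Consider the observer $\dot{\hat x}_d=(A_d^\star+B_dF_{dd})\hat x_d+B_d(F_{da}\hat x_a+F_{db}\hat x_b)+B_{0d}y_0+H_{dd}y_d+l_d(e_{d,y})$, where $e_{d,y}=y_d-C_d\hat x_d$, whose $i$-th component is $e_{d,w_i}:=x_{d,w_i}-\hat x_{d,w_i}$ with $w_i=\sum_{j=1}^{i-1}q_j+1$, and $l_d:\mathbb R^{m_d}\to\mathbb R^{n_d}$ has component with index $w_i+j-1$ equal to $\kappa_{i,j}\lfloor e_{d,w_i}\rceil^{(q_i-j)/q_i}$ for $i=1,\dots,m_d$, $j=1,\dots,q_i$, with gains $\kappa_{i,j}>0$. Then there exist sufficiently large gains $\kappa_{i,j}>0$ such that for every initial condition of the system and of the observers there is a finite time $T_f$ with $x_d(t)-\hat x_d(t)=0$ for all $t\ge T_f$.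
   Context: Notation: for an integer $k\ge 1$, $J_k\in\mathbb R^{k\times k}$ is the matrix with ones on the first superdiagonal and zeros elsewhere, $B_k=[0\ \cdots\ 0\ 1]^\top\in\mathbb R^{k}$, $C_k=[1\ 0\ \cdots\ 0]\in\mathbb R^{1\times k}$, and $\mathrm{diag}(\cdot)$ denotes a (block) diagonal matrix. For $z\in\mathbb R$, $\lfloor z\rceil^a=\mathrm{sign}(z)|z|^a$ and $\lfloor z\rceil^0=\mathrm{sign}(z)$; solutions of differential equations with discontinuous right-hand side are understood in the sense of Filippov. Consider the linear time-invariant system $\Sigma$: $\dot x=Ax+Bu$, $y=Cx+Du$, with $x\in\mathbb R^n$, $u\in\mathbb R^m$, $y\in\mathbb R^p$, $\operatorname{rank}D=m_0$, and with $[B^\top\ D^\top]$ and $[C\ D]$ of full rank. Special coordinate basis (SCB): $\Sigma$ is in SCB if its state, input and output are partitioned as $x=(x_a,x_b,x_c,x_d)$ with $x_a\in\mathbb R^{n_a},x_b\in\mathbb R^{n_b},x_c\in\mathbb R^{n_c},x_d\in\mathbb R^{n_d}$, $u=(u_0,u_d,u_c)$ with $u_0\in\mathbb R^{m_0},u_d\in\mathbb R^{m_d},u_c\in\mathbb R^{m_c}$, $y=(y_0,y_d,y_b)$ with $y_0\in\mathbb R^{m_0},y_d\in\mathbb R^{m_d},y_b\in\mathbb R^{p_b}$, such that $y_0=C_{0a}x_a+C_{0b}x_b+C_{0c}x_c+C_{0d}x_d+u_0$, $y_d=C_dx_d$, $y_b=C_bx_b$, $\dot x_a=A_ax_a+H_{ab}C_bx_b+H_{ad}C_dx_d+B_{0a}y_0$,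 $\dot x_b=A_bx_b+H_{bd}C_dx_d+B_{0b}y_0$, $\dot x_c=B_cF_{ca}x_a+H_{cb}C_bx_b+A_cx_c+H_{cd}C_dx_d+B_{0c}y_0+B_cu_c$, $\dot x_d=B_dF_{da}x_a+B_dF_{db}x_b+B_dF_{dc}x_c+A_dx_d+B_{0d}y_0+B_du_d$, with constant real matrices of appropriate dimensions, where $A_b=\mathrm{diag}(J_{l_1},\dots,J_{l_{p_b}})+H_{bb}C_b$, $C_b=\mathrm{diag}(C_{l_1},\dots,C_{l_{p_b}})$ for positive integers $l_i$ with $\sum_i l_i=n_b$; $B_d=\mathrm{diag}(B_{q_1},\dots,B_{q_{m_d}})$, $C_d=\mathrm{diag}(C_{q_1},\dots,C_{q_{m_d}})$ for integers $q_1\ge q_2\ge\dots\ge q_{m_d}\ge 1$ with $\sum_i q_i=n_d$; and $A_d=A_d^\star+B_dF_{dd}+H_{dd}C_d$ with $A_d^\star=\mathrm{diag}(J_{q_1},\dots,J_{q_{m_d}})$, $F_{dd}\in\mathbb R^{m_d\times n_d}$, $H_{dd}\in\mathbb R^{n_d\times m_d}$. Structure of $F_{dd}$: partition the columns of $F_{dd}$ into consecutive blocks of widths $q_1,\dots,q_{m_d}$ and denote by $f_{i,j,k}$ the entry of row $i$ in the $k$-th column of block $j$; the structure requires $f_{i,j,k}=0$ whenever $j\ge i$ or $k=1$ (such an SCB always exists). $\Sigma$ is strongly detectable if $y(t)=0$ for all $t\ge0$ implies $x(t)\to0$ as $t\to\infty$, for all inputs and initial states; for a system in SCB this is equivalent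 to $n_c=0$ and $A_a$ Hurwitz (so the blocks $x_c,u_c$ are absent). Also, $(A_b,C_b)$ is observable in any SCB. *)

theory Defs
  imports "HOL-Analysis.Analysis"
begin

definition abs_cont_on :: "real \<Rightarrow> real \<Rightarrow> (real \<Rightarrow> 'a::real_normed_vector) \<Rightarrow> bool" where
  "abs_cont_on a b f \<longleftrightarrow>
     (\<forall>\<epsilon>>0. \<exists>\<delta>>0. \<forall>n (s::nat \<Rightarrow> real) (e::nat \<Rightarrow> real).
        (\<forall>k<n. a \<le> s k \<and> s k \<le> e k \<and> e k \<le> b) \<and>
        (\<forall>k<n. \<forall>k'<n. k \<noteq> k' \<longrightarrow> e k \<le> s k' \<or> e k' \<le> s k) \<and>
        (\<Sum>k<n. e k - s k) < \<delta>
        \<longrightarrow> (\<Sum>k<n. norm (f (e k) - f (s k))) < \<epsilon>)"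

definition filippov_set :: "('a::euclidean_space \<Rightarrow> 'a) \<Rightarrow> 'a \<Rightarrow> 'a set" where
  "filippov_set f x =
     (\<Inter>\<delta>\<in>{0<..}. \<Inter>N\<in>null_sets lebesgue. closure (convex hull (f ` (ball x \<delta> - N))))"

definition filippov_solution :: "(real \<Rightarrow> 'a::euclidean_space \<Rightarrow> 'a) \<Rightarrow> (real \<Rightarrow> 'a) \<Rightarrow> bool" where
  "filippov_solution F z \<longleftrightarrow>
     (\<forall>T\<ge>0. abs_cont_on 0 T z) \<and>
     (AE t in lborel. 0 < t \<longrightarrow>
        (\<exists>d. (z has_vector_derivative d) (at t) \<and> d \<in> filippov_set (F t) (z t)))"

text \<open>Vectors are \<open>nat \<Rightarrow> real\<close> (only the first n entries matter), matrices \<open>nat \<Rightarrow> nat \<Rightarrow> real\<close>.\<close>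
definition mv :: "(nat \<Rightarrow> nat \<Rightarrow> real) \<Rightarrow> nat \<Rightarrow> (nat \<Rightarrow> real) \<Rightarrow> nat \<Rightarrow> real" where
  "mv M n v = (\<lambda>i. \<Sum>j<n. M i j * v j)"

definition mm :: "(nat \<Rightarrow> nat \<Rightarrow> real) \<Rightarrow> nat \<Rightarrow> (nat \<Rightarrow> nat \<Rightarrow> real) \<Rightarrow> nat \<Rightarrow> nat \<Rightarrow> real" where
  "mm M n P = (\<lambda>i k. \<Sum>j<n. M i j * P j k)"

definition hurwitz :: "nat \<Rightarrow> (nat \<Rightarrow> nat \<Rightarrow> real) \<Rightarrow> bool" where
  "hurwitz n A \<longleftrightarrow>
     (\<forall>(ev::complex) (v::nat \<Rightarrow> complex).
        (\<exists>k<n. v k \<noteq> 0) \<and> (\<forall>i<n. (\<Sum>j<n. complex_of_real (A i j) * v j) = ev * v i)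
        \<longrightarrow> Re ev < 0)"

text \<open>Block offsets (0-based): block i occupies indices offs q i, ..., offs q i + q i - 1.\<close>
definition offs :: "(nat \<Rightarrow> nat) \<Rightarrow> nat \<Rightarrow> nat" where
  "offs q i = (\<Sum>j<i. q j)"

text \<open>diag(J_{q_1},...,J_{q_m})\<close>
definition Jblk :: "(nat \<Rightarrow> nat) \<Rightarrow> nat \<Rightarrow> nat \<Rightarrow> nat \<Rightarrow> real" where
  "Jblk q m r c = (if \<exists>i<m. \<exists>j. Suc j < q i \<and> r = offs q i + j \<and> c = Suc r then 1 else 0)"

text \<open>diag(B_{q_1},...,B_{q_m}) (size (sum q) x m)\<close>
definition Bblk :: "(nat \<Rightarrow> nat) \<Rightarrow> nat \<Rightarrow> nat \<Rightarrow> nat \<Rightarrow> real" where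
  "Bblk q m r c = (if c < m \<and> r = offs q c + (q c - 1) then 1 else 0)"

text \<open>diag(C_{q_1},...,C_{q_m}) (size m x (sum q))\<close>
definition Cblk :: "(nat \<Rightarrow> nat) \<Rightarrow> nat \<Rightarrow> nat \<Rightarrow> nat \<Rightarrow> real" where
  "Cblk q m r c = (if r < m \<and> c = offs q r then 1 else 0)"

definition spow :: "real \<Rightarrow> real \<Rightarrow> real" where
  "spow z a = (if a = 0 then sgn z else sgn z * \<bar>z\<bar> powr a)"

record scb_sys =
  na :: nat  nb :: nat  nd :: nat  m0 :: nat  md :: nat  pb :: nat
  lb :: "nat \<Rightarrow> nat"     \<comment> \<open>l_1,...,l_{p_b} (0-based index)\<close>
  qd :: "nat \<Rightarrow> nat"     \<comment> \<open>q_1,...,q_{m_d} (0-based index)\<close>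
  C0a :: "nat \<Rightarrow> nat \<Rightarrow> real"  C0b :: "nat \<Rightarrow> nat \<Rightarrow> real"  C0d :: "nat \<Rightarrow> nat \<Rightarrow> real"
  Aa :: "nat \<Rightarrow> nat \<Rightarrow> real"  Hab :: "nat \<Rightarrow> nat \<Rightarrow> real"  Had :: "nat \<Rightarrow> nat \<Rightarrow> real"
  B0a :: "nat \<Rightarrow> nat \<Rightarrow> real"
  Ab :: "nat \<Rightarrow> nat \<Rightarrow> real"  Hbd :: "nat \<Rightarrow> nat \<Rightarrow> real"  B0b :: "nat \<Rightarrow> nat \<Rightarrow> real"
  Hbb :: "nat \<Rightarrow> nat \<Rightarrow> real"  Cb :: "nat \<Rightarrow> nat \<Rightarrow> real"
  Fda :: "nat \<Rightarrow> nat \<Rightarrow> real"  Fdb :: "nat \<Rightarrow> nat \<Rightarrow> real"  Ad :: "nat \<Rightarrow> nat \<Rightarrow> real"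
  B0d :: "nat \<Rightarrow> nat \<Rightarrow> real"  Bd :: "nat \<Rightarrow> nat \<Rightarrow> real"  Cd :: "nat \<Rightarrow> nat \<Rightarrow> real"
  Fdd :: "nat \<Rightarrow> nat \<Rightarrow> real"  Hdd :: "nat \<Rightarrow> nat \<Rightarrow> real"

text \<open>Structural requirements of the SCB (without the c-block, i.e. n_c = 0).\<close>
definition in_scb :: "scb_sys \<Rightarrow> bool" where
  "in_scb S \<longleftrightarrow>
     (\<forall>i<pb S. 1 \<le> lb S i) \<and> (\<Sum>i<pb S. lb S i) = nb S \<and>
     (\<forall>i<md S. 1 \<le> qd S i) \<and> (\<forall>i j. i \<le> j \<and> j < md S \<longrightarrow> qd S j \<le> qd S i) \<and>
     (\<Sum>i<md S. qd S i) = nd S \<and>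
     (\<forall>r<pb S. \<forall>c<nb S. Cb S r c = Cblk (lb S) (pb S) r c) \<and>
     (\<forall>r<nb S. \<forall>c<nb S. Ab S r c = Jblk (lb S) (pb S) r c + mm (Hbb S) (pb S) (Cb S) r c) \<and>
     (\<forall>r<nd S. \<forall>c<md S. Bd S r c = Bblk (qd S) (md S) r c) \<and>
     (\<forall>r<md S. \<forall>c<nd S. Cd S r c = Cblk (qd S) (md S) r c) \<and>
     (\<forall>r<nd S. \<forall>c<nd S. Ad S r c = Jblk (qd S) (md S) r c + mm (Bd S) (md S) (Fdd S) r c
                                   + mm (Hdd S) (md S) (Cd S) r c)"

text \<open>Structure of F_dd: f_{i,j,k} = 0 whenever j \<ge> i or k = 1 (here all indices 0-based).\<close>
definition Fdd_structured :: "scb_sys \<Rightarrow> bool" where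
  "Fdd_structured S \<longleftrightarrow>
     (\<forall>r<md S. \<forall>jb<md S. \<forall>kk<qd S jb. (r \<le> jb \<or> kk = 0) \<longrightarrow> Fdd S r (offs (qd S) jb + kk) = 0)"

definition sub :: "nat \<Rightarrow> (nat \<Rightarrow> real) \<Rightarrow> nat \<Rightarrow> real" where
  "sub off v = (\<lambda>k. v (off + k))"

definition cat :: "nat \<Rightarrow> (nat \<Rightarrow> real) \<Rightarrow> (nat \<Rightarrow> real) \<Rightarrow> nat \<Rightarrow> real" where
  "cat n v w = (\<lambda>k. if k < n then v k else w (k - n))"

definition ld :: "(nat \<Rightarrow> nat) \<Rightarrow> nat \<Rightarrow> (nat \<Rightarrow> nat \<Rightarrow> real) \<Rightarrow> (nat \<Rightarrow> real) \<Rightarrow> nat \<Rightarrow> real" where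
  "ld q m \<kappa> e = (\<lambda>r. \<Sum>i<m. \<Sum>j<q i.
      if r = offs q i + j then \<kappa> i j * spow (e i) (real (q i - Suc j) / real (q i)) else 0)"

text \<open>Offsets of the blocks of the closed-loop state
  (x_a, x_b, x_d, xhat_a, xhat_b, xhat_d).\<close>
definition off_xd :: "scb_sys \<Rightarrow> nat" where "off_xd S = na S + nb S"
definition off_ha :: "scb_sys \<Rightarrow> nat" where "off_ha S = na S + nb S + nd S"
definition off_hb :: "scb_sys \<Rightarrow> nat" where "off_hb S = 2 * na S + nb S + nd S"
definition off_hd :: "scb_sys \<Rightarrow> nat" where "off_hd S = 2 * na S + 2 * nb S + nd S"
definition cl_dim :: "scb_sys \<Rightarrow> nat" where "cl_dim S = 2 * (na S + nb S + nd S)"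

definition cl_rhs ::
  "scb_sys \<Rightarrow> (nat \<Rightarrow> nat \<Rightarrow> real) \<Rightarrow> (nat \<Rightarrow> nat \<Rightarrow> real) \<Rightarrow>
   (real \<Rightarrow> nat \<Rightarrow> real) \<Rightarrow> (real \<Rightarrow> nat \<Rightarrow> real) \<Rightarrow> real \<Rightarrow> (nat \<Rightarrow> real) \<Rightarrow> nat \<Rightarrow> real" where
  "cl_rhs S Lb \<kappa> u0 ud t v =
    (let xa = sub 0 v; xb = sub (na S) v; xd = sub (off_xd S) v;
         ha = sub (off_ha S) v; hb = sub (off_hb S) v; hd = sub (off_hd S) v;
         y0 = (\<lambda>i. mv (C0a S) (na S) xa i + mv (C0b S) (nb S) xb i + mv (C0d S) (nd S) xd i + u0 t i);
         yd = mv (Cd S) (nd S) xd;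
         yb = mv (Cb S) (nb S) xb;
         ga = (\<lambda>i. mv (Aa S) (na S) xa i + mv (Hab S) (pb S) yb i + mv (Had S) (md S) yd i
                  + mv (B0a S) (m0 S) y0 i);
         gb = (\<lambda>i. mv (Ab S) (nb S) xb i + mv (Hbd S) (md S) yd i + mv (B0b S) (m0 S) y0 i);
         gd = (\<lambda>i. mv (Bd S) (md S) (\<lambda>k. mv (Fda S) (na S) xa k + mv (Fdb S) (nb S) xb k + ud t k) i
                  + mv (Ad S) (nd S) xd i + mv (B0d S) (m0 S) y0 i);
         gha = (\<lambda>i. mv (Aa S) (na S) ha i + mv (Hab S) (pb S) yb i + mv (Had S) (md S) yd i
                  + mv (B0a S) (m0 S) y0 i);
         ghb = (\<lambda>i. mv (Ab S) (nb S) hb i + mv (Hbd S) (md S) yd i + mv (B0b S) (m0 S) y0 i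
                  + mv Lb (pb S) (\<lambda>k. yb k - mv (Cb S) (nb S) hb k) i);
         edy = (\<lambda>k. yd k - mv (Cd S) (nd S) hd k);
         ghd = (\<lambda>i. mv (\<lambda>r c. Jblk (qd S) (md S) r c + mm (Bd S) (md S) (Fdd S) r c) (nd S) hd i
                  + mv (Bd S) (md S) (\<lambda>k. mv (Fda S) (na S) ha k + mv (Fdb S) (nb S) hb k) i
                  + mv (B0d S) (m0 S) y0 i + mv (Hdd S) (md S) yd i
                  + ld (qd S) (md S) \<kappa> edy i)
     in cat (na S) ga (cat (nb S) gb (cat (nd S) gd (cat (na S) gha (cat (nb S) ghb ghd)))))"

text \<open>Transport between nat-indexed coordinates 0..N-1 and a Euclidean space real^'n,
  via a bijection \<iota> : {..<N} \<rightarrow> 'n.\<close>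
definition dec :: "(nat \<Rightarrow> 'n::finite) \<Rightarrow> real^'n \<Rightarrow> nat \<Rightarrow> real" where
  "dec \<iota> z = (\<lambda>k. z $ \<iota> k)"

definition enc :: "(nat \<Rightarrow> 'n::finite) \<Rightarrow> nat \<Rightarrow> (nat \<Rightarrow> real) \<Rightarrow> real^'n" where
  "enc \<iota> N v = (\<chi> c. v (inv_into {..<N} \<iota> c))"

end

theory Submission
  imports Defs "Jordan_Normal_Form.Schur_Decomposition"
begin

text \<open>The errors \<open>x_a - xhat_a\<close> and \<open>x_b - xhat_b\<close> obey autonomous Hurwitz systems and tend to zero.
  Block \<open>i\<close> of the error \<open>x_d - xhat_d\<close> is the error chain of a homogeneous differentiator of order
  \<open>q_i\<close>, perturbed by the unknown input, by the first two errors and, since \<open>F_dd\<close> is strictly lower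
  block triangular, by the blocks before it. By induction on \<open>i\<close> the latter vanish after finite time, so the
  perturbation is eventually bounded by \<open>\<Delta>_i + 1\<close>, and it suffices that gains exist for which
  the differentiator converges in finite time under a bounded perturbation.

  Those gains come from a homogeneous Lyapunov function \<open>V\<close> of degree \<open>p\<close>, built by induction on the
  order. Along solutions \<open>V\<close> decreases at a rate proportional to \<open>V powr (1 - 1/p)\<close>, hence reaches zero
  in finite time.\<close>

subsection \<open>Absolutely continuous functions\<close>

text \<open>The order of quantifiers shapes the argument. The gains are fixed before the initial
  conditions, while \<open>x_a - xhat_a\<close> and \<open>x_b - xhat_b\<close> have no bound
  uniform in those. So convergence of a chain is proved from an arbitrary starting time and state,
  under a bound valid from that time on. The transient before it only costs time, since a Filippov
  solution is by definition given on all of [0, infinity). The 1 in \<Delta>_i + 1 is an arbitrary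
  margin for couplings that have become small.

  A second obstacle is that a Filippov velocity is one vector from closed convex hulls taken jointly
  over all coordinates. The error equations involve only scalar linear functionals of it: those with
  a continuous right-hand side are evaluated exactly, and the last equation of each block yields a
  number in the set-valued sign.

  Exact convergence under a bounded disturbance is possible because the disturbance and the sign
  term both have homogeneity weight 0.\<close>

lemma abs_cont_on_dominated:
  fixes g :: "real \<Rightarrow> 'c::real_normed_vector"
  assumes f: "abs_cont_on a b f" and h: "abs_cont_on a b h"
    and le: "\<And>s t. s \<in> {a..b} \<Longrightarrow> t \<in> {a..b} \<Longrightarrow>
      norm (g t - g s) \<le> C * (norm (f t - f s) + norm (h t - h s))"
  shows "abs_cont_on a b g"
  unfolding abs_cont_on_def
proof (intro allI impI)
  fix \<epsilon> :: real assume "\<epsilon> > 0"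
  \<comment> \<open>Only a positive factor can divide \<open>\<epsilon>\<close>, and
    \<open>C\<close> may be 0: constants are handled as Lipschitz images with
    \<open>C = 0\<close>.\<close>
  define D where "D = max C 1"
  have D: "D > 0" "C \<le> D" by (auto simp: D_def)
  have e: "\<epsilon> / (2 * D) > 0" using \<open>\<epsilon> > 0\<close> D by simp
  obtain d1 where d1: "d1 > 0" "\<And>n (s::nat \<Rightarrow> real) e. (\<forall>k<n. a \<le> s k \<and> s k \<le> e k \<and> e k \<le> b) \<and>
        (\<forall>k<n. \<forall>k'<n. k \<noteq> k' \<longrightarrow> e k \<le> s k' \<or> e k' \<le> s k) \<and>
        (\<Sum>k<n. e k - s k) < d1 \<Longrightarrow> (\<Sum>k<n. norm (f (e k) - f (s k))) < \<epsilon> / (2 * D)"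
    using f[unfolded abs_cont_on_def, rule_format, OF e] by blast
  obtain d2 where d2: "d2 > 0" "\<And>n (s::nat \<Rightarrow> real) e. (\<forall>k<n. a \<le> s k \<and> s k \<le> e k \<and> e k \<le> b) \<and>
        (\<forall>k<n. \<forall>k'<n. k \<noteq> k' \<longrightarrow> e k \<le> s k' \<or> e k' \<le> s k) \<and>
        (\<Sum>k<n. e k - s k) < d2 \<Longrightarrow> (\<Sum>k<n. norm (h (e k) - h (s k))) < \<epsilon> / (2 * D)"
    using h[unfolded abs_cont_on_def, rule_format, OF e] by blast
  show "\<exists>\<delta>>0. \<forall>n (s::nat \<Rightarrow> real) e. (\<forall>k<n. a \<le> s k \<and> s k \<le> e k \<and> e k \<le> b) \<and>
        (\<forall>k<n. \<forall>k'<n. k \<noteq> k' \<longrightarrow> e k \<le> s k' \<or> e k' \<le> s k) \<and>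
        (\<Sum>k<n. e k - s k) < \<delta> \<longrightarrow> (\<Sum>k<n. norm (g (e k) - g (s k))) < \<epsilon>"
  proof (intro exI[of _ "min d1 d2"] conjI allI impI)
    fix n :: nat and s e :: "nat \<Rightarrow> real"
    assume A: "(\<forall>k<n. a \<le> s k \<and> s k \<le> e k \<and> e k \<le> b) \<and>
        (\<forall>k<n. \<forall>k'<n. k \<noteq> k' \<longrightarrow> e k \<le> s k' \<or> e k' \<le> s k) \<and>
        (\<Sum>k<n. e k - s k) < min d1 d2"
    have "(\<Sum>k<n. norm (g (e k) - g (s k)))
        \<le> (\<Sum>k<n. D * (norm (f (e k) - f (s k)) + norm (h (e k) - h (s k))))"
    proof (rule sum_mono)
      fix k assume "k \<in> {..<n}"
      with A have "a \<le> s k" "s k \<le> e k" "e k \<le> b" by auto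
      then have "norm (g (e k) - g (s k)) \<le> C * (norm (f (e k) - f (s k)) + norm (h (e k) - h (s k)))"
        by (intro le) auto
      also have "\<dots> \<le> D * (norm (f (e k) - f (s k)) + norm (h (e k) - h (s k)))"
        using D by (intro mult_right_mono) auto
      finally show "norm (g (e k) - g (s k)) \<le> \<dots>" .
    qed
    also have "\<dots> = D * ((\<Sum>k<n. norm (f (e k) - f (s k))) + (\<Sum>k<n. norm (h (e k) - h (s k))))"
      by (simp add: sum_distrib_left sum.distrib distrib_left)
    also have "\<dots> < D * (\<epsilon> / (2 * D) + \<epsilon> / (2 * D))"
      using d1(2)[of n s e] d2(2)[of n s e] A D by (intro mult_strict_left_mono add_strict_mono) auto
    also have "\<dots> = \<epsilon>" using D by (simp add: field_simps)
    finally show "(\<Sum>k<n. norm (g (e k) - g (s k))) < \<epsilon>" .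
  qed (use d1 d2 in auto)
qed

lemma abs_cont_on_subset:
  assumes "abs_cont_on a b f" "a \<le> c" "d \<le> b"
  shows "abs_cont_on c d f"
  unfolding abs_cont_on_def
proof (intro allI impI)
  fix \<epsilon> :: real assume "\<epsilon> > 0"
  with assms(1) obtain \<delta> where d: "\<delta> > 0" "\<And>n (s::nat \<Rightarrow> real) e. (\<forall>k<n. a \<le> s k \<and> s k \<le> e k \<and> e k \<le> b) \<and>
        (\<forall>k<n. \<forall>k'<n. k \<noteq> k' \<longrightarrow> e k \<le> s k' \<or> e k' \<le> s k) \<and>
        (\<Sum>k<n. e k - s k) < \<delta> \<Longrightarrow> (\<Sum>k<n. norm (f (e k) - f (s k))) < \<epsilon>"
    unfolding abs_cont_on_def by blast
  show "\<exists>\<delta>>0. \<forall>n (s::nat \<Rightarrow> real) e. (\<forall>k<n. c \<le> s k \<and> s k \<le> e k \<and> e k \<le> d) \<and>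
        (\<forall>k<n. \<forall>k'<n. k \<noteq> k' \<longrightarrow> e k \<le> s k' \<or> e k' \<le> s k) \<and>
        (\<Sum>k<n. e k - s k) < \<delta> \<longrightarrow> (\<Sum>k<n. norm (f (e k) - f (s k))) < \<epsilon>"
  proof (intro exI[of _ \<delta>] conjI allI impI)
    fix n :: nat and s e :: "nat \<Rightarrow> real"
    assume A: "(\<forall>k<n. c \<le> s k \<and> s k \<le> e k \<and> e k \<le> d) \<and>
        (\<forall>k<n. \<forall>k'<n. k \<noteq> k' \<longrightarrow> e k \<le> s k' \<or> e k' \<le> s k) \<and> (\<Sum>k<n. e k - s k) < \<delta>"
    then have "\<forall>k<n. a \<le> s k \<and> s k \<le> e k \<and> e k \<le> b" using assms(2,3) by force
    with A show "(\<Sum>k<n. norm (f (e k) - f (s k))) < \<epsilon>" using d(2) by blast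
  qed (use d in auto)
qed

lemma abs_cont_on_ident: "abs_cont_on a b (\<lambda>t::real. t)"
  unfolding abs_cont_on_def
proof (intro allI impI)
  fix \<epsilon> :: real assume "\<epsilon> > 0"
  show "\<exists>\<delta>>0. \<forall>n (s::nat \<Rightarrow> real) e. (\<forall>k<n. a \<le> s k \<and> s k \<le> e k \<and> e k \<le> b) \<and>
        (\<forall>k<n. \<forall>k'<n. k \<noteq> k' \<longrightarrow> e k \<le> s k' \<or> e k' \<le> s k) \<and>
        (\<Sum>k<n. e k - s k) < \<delta> \<longrightarrow> (\<Sum>k<n. norm (e k - s k)) < \<epsilon>"
  proof (intro exI[of _ \<epsilon>] conjI allI impI)
    fix n :: nat and s e :: "nat \<Rightarrow> real"
    assume A: "(\<forall>k<n. a \<le> s k \<and> s k \<le> e k \<and> e k \<le> b) \<and>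
        (\<forall>k<n. \<forall>k'<n. k \<noteq> k' \<longrightarrow> e k \<le> s k' \<or> e k' \<le> s k) \<and> (\<Sum>k<n. e k - s k) < \<epsilon>"
    then have "(\<Sum>k<n. norm (e k - s k)) = (\<Sum>k<n. e k - s k)"
      by (intro sum.cong) auto
    with A show "(\<Sum>k<n. norm (e k - s k)) < \<epsilon>" by simp
  qed fact
qed

lemma abs_cont_on_lipschitz:
  fixes g :: "real \<Rightarrow> 'c::real_normed_vector"
  assumes "abs_cont_on a b f"
    and "\<And>s t. s \<in> {a..b} \<Longrightarrow> t \<in> {a..b} \<Longrightarrow> norm (g t - g s) \<le> C * norm (f t - f s)"
  shows "abs_cont_on a b g"
proof (rule abs_cont_on_dominated[where C="C/2", OF assms(1,1)])
  fix s t assume "s \<in> {a..b}" "t \<in> {a..b}"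
  then show "norm (g t - g s) \<le> C / 2 * (norm (f t - f s) + norm (f t - f s))"
    using assms(2)[of s t] by (simp add: field_simps)
qed

lemma abs_cont_on_const: "abs_cont_on a b (\<lambda>t. c)"
  by (rule abs_cont_on_lipschitz[where C=0, OF abs_cont_on_ident]) simp

lemma abs_cont_on_add:
  assumes "abs_cont_on a b f" "abs_cont_on a b g"
  shows "abs_cont_on a b (\<lambda>t. f t + g t)"
  by (rule abs_cont_on_dominated[where C=1, OF assms])
     (simp add: add_diff_add norm_triangle_ineq)

lemma abs_cont_on_bounded_linear:
  assumes "abs_cont_on a b f" "bounded_linear L"
  shows "abs_cont_on a b (\<lambda>t. L (f t))"
proof -
  interpret bounded_linear L by fact
  obtain K where K: "\<And>x. norm (L x) \<le> norm x * K" using bounded by blast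
  show ?thesis
    by (rule abs_cont_on_lipschitz[where C=K, OF assms(1)])
       (metis K diff mult.commute)
qed

lemma abs_cont_on_cmult:
  fixes f :: "real \<Rightarrow> 'a::real_normed_algebra"
  shows "abs_cont_on a b f \<Longrightarrow> abs_cont_on a b (\<lambda>t. c * f t)"
  by (rule abs_cont_on_bounded_linear[OF _ bounded_linear_mult_right])

lemma abs_cont_on_diff:
  assumes "abs_cont_on a b f" "abs_cont_on a b g"
  shows "abs_cont_on a b (\<lambda>t. f t - g t)"
  using abs_cont_on_add[OF assms(1) abs_cont_on_bounded_linear[OF assms(2) bounded_linear_minus[OF bounded_linear_ident]]]
  by simp

lemma abs_cont_on_sum:
  assumes "\<And>i. i \<in> I \<Longrightarrow> abs_cont_on a b (f i)"
  shows "abs_cont_on a b (\<lambda>t. \<Sum>i\<in>I. f i t)"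
  using assms
  by (induction I rule: infinite_finite_induct) (auto intro: abs_cont_on_const abs_cont_on_add)

lemma abs_cont_on_continuous_on:
  assumes "abs_cont_on a b f"
  shows "continuous_on {a..b} f"
  unfolding continuous_on_iff
proof (intro ballI allI impI)
  fix x \<epsilon> :: real assume x: "x \<in> {a..b}" "\<epsilon> > 0"
  with assms obtain \<delta> where d: "\<delta> > 0" "\<And>n (s::nat \<Rightarrow> real) e. (\<forall>k<n. a \<le> s k \<and> s k \<le> e k \<and> e k \<le> b) \<and>
        (\<forall>k<n. \<forall>k'<n. k \<noteq> k' \<longrightarrow> e k \<le> s k' \<or> e k' \<le> s k) \<and>
        (\<Sum>k<n. e k - s k) < \<delta> \<Longrightarrow> (\<Sum>k<n. norm (f (e k) - f (s k))) < \<epsilon>"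
    unfolding abs_cont_on_def by blast
  show "\<exists>d>0. \<forall>x'\<in>{a..b}. dist x' x < d \<longrightarrow> dist (f x') (f x) < \<epsilon>"
  proof (intro exI[of _ \<delta>] conjI ballI impI)
    fix x' assume "x' \<in> {a..b}" "dist x' x < \<delta>"
    \<comment> \<open>A family of one interval, with sorted endpoints because the definition asks
      for \<open>s k \<le> e k\<close>.\<close>
    then have "norm (f (max x x') - f (min x x')) < \<epsilon>"
      using d(2)[of "1::nat" "\<lambda>_. min x x'" "\<lambda>_. max x x'"] x
      by (auto simp: dist_real_def max_def min_def)
    then show "dist (f x') (f x) < \<epsilon>"
      by (auto simp: dist_norm max_def min_def norm_minus_commute split: if_splits)
  qed fact
qed

lemma abs_cont_on_bounded:
  assumes "abs_cont_on a b f"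
  obtains M where "M > 0" "\<And>t. t \<in> {a..b} \<Longrightarrow> norm (f t) \<le> M"
proof -
  have "bounded (f ` {a..b})"
    using abs_cont_on_continuous_on[OF assms] compact_continuous_image compact_imp_bounded by blast
  then obtain M where "M > 0" "\<forall>x\<in>f ` {a..b}. norm x \<le> M" unfolding bounded_pos by blast
  then show thesis by (intro that[of M]) auto
qed

lemma abs_cont_on_mult:
  fixes f g :: "real \<Rightarrow> 'a::real_normed_algebra"
  assumes f: "abs_cont_on a b f" and g: "abs_cont_on a b g"
  shows "abs_cont_on a b (\<lambda>t. f t * g t)"
proof -
  obtain M where M: "M > 0" "\<And>t. t \<in> {a..b} \<Longrightarrow> norm (f t) \<le> M"
    by (rule abs_cont_on_bounded[OF f], rule that)
  obtain N where N: "N > 0" "\<And>t. t \<in> {a..b} \<Longrightarrow> norm (g t) \<le> N"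
    by (rule abs_cont_on_bounded[OF g], rule that)
  show ?thesis
  proof (rule abs_cont_on_dominated[OF f g, where C="M + N"])
    fix s t assume st: "s \<in> {a..b}" "t \<in> {a..b}"
    have "f t * g t - f s * g s = f t * (g t - g s) + (f t - f s) * g s" by (simp add: algebra_simps)
    also have "norm \<dots> \<le> norm (f t) * norm (g t - g s) + norm (f t - f s) * norm (g s)"
      by (meson add_mono norm_mult_ineq norm_triangle_mono order_trans)
    also have "\<dots> \<le> M * norm (g t - g s) + norm (f t - f s) * N"
      using M N st by (intro add_mono mult_right_mono mult_left_mono) auto
    also have "\<dots> \<le> (M + N) * (norm (f t - f s) + norm (g t - g s))"
      using M N by (simp add: algebra_simps)
    finally show "norm (f t * g t - f s * g s) \<le> \<dots>" .
  qed
qed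

lemma abs_cont_on_power:
  fixes f :: "real \<Rightarrow> 'a::real_normed_algebra_1"
  assumes "abs_cont_on a b f"
  shows "abs_cont_on a b (\<lambda>t. f t ^ n)"
  by (induction n) (auto intro: abs_cont_on_const abs_cont_on_mult assms)

text \<open>By the mean value bound, \<open>G\<close> need be C1 only near the values of
  \<open>f\<close>. This admits roots, which are not Lipschitz at 0, as long as the values of
  \<open>f\<close> stay away from 0.\<close>

lemma abs_cont_on_C1_compose:
  fixes f :: "real \<Rightarrow> real"
  assumes f: "abs_cont_on a b f" and S: "convex S" "compact S" "f ` {a..b} \<subseteq> S"
    and G: "\<And>x. x \<in> S \<Longrightarrow> (G has_real_derivative G' x) (at x)" and G': "continuous_on S G'"
  shows "abs_cont_on a b (\<lambda>t. G (f t))"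
proof -
  obtain M where M: "\<And>x. x \<in> S \<Longrightarrow> norm (G' x) \<le> M"
    using compact_imp_bounded[OF compact_continuous_image[OF G' S(2)]] unfolding bounded_pos by auto
  show ?thesis
  proof (rule abs_cont_on_lipschitz[OF f, where C=M])
    fix s t assume "s \<in> {a..b}" "t \<in> {a..b}"
    then show "norm (G (f t) - G (f s)) \<le> M * norm (f t - f s)"
      using S M G
      by (intro field_differentiable_bound[of S G G' M]) (auto intro: has_field_derivative_at_within)
  qed
qed

text \<open>Frees the definition from the index set of initial segments; the application is to
  tagged intervals of a gauge division.\<close>

lemma abs_cont_on_finite_family:
  fixes f :: "real \<Rightarrow> 'a::real_normed_vector"
  assumes "abs_cont_on a b f" "\<epsilon> > 0"
  shows "\<exists>\<delta>>0. \<forall>(I::'i set) s e. finite I \<longrightarrow> (\<forall>i\<in>I. a \<le> s i \<and> s i \<le> e i \<and> e i \<le> b) \<longrightarrow>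
      (\<forall>i\<in>I. \<forall>j\<in>I. i \<noteq> j \<longrightarrow> e i \<le> s j \<or> e j \<le> s i) \<longrightarrow> (\<Sum>i\<in>I. e i - s i) < \<delta> \<longrightarrow>
      (\<Sum>i\<in>I. norm (f (e i) - f (s i))) < \<epsilon>"
proof -
  from assms obtain \<delta> where d: "\<delta> > 0" "\<And>n (s::nat \<Rightarrow> real) e. (\<forall>k<n. a \<le> s k \<and> s k \<le> e k \<and> e k \<le> b) \<and>
        (\<forall>k<n. \<forall>k'<n. k \<noteq> k' \<longrightarrow> e k \<le> s k' \<or> e k' \<le> s k) \<and>
        (\<Sum>k<n. e k - s k) < \<delta> \<Longrightarrow> (\<Sum>k<n. norm (f (e k) - f (s k))) < \<epsilon>"
    unfolding abs_cont_on_def by blast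
  show ?thesis
  proof (intro exI[of _ \<delta>] conjI allI impI d(1))
    fix I :: "'i set" and s e :: "'i \<Rightarrow> real"
    assume I: "finite I" "\<forall>i\<in>I. a \<le> s i \<and> s i \<le> e i \<and> e i \<le> b"
      "\<forall>i\<in>I. \<forall>j\<in>I. i \<noteq> j \<longrightarrow> e i \<le> s j \<or> e j \<le> s i" "(\<Sum>i\<in>I. e i - s i) < \<delta>"
    obtain h where h: "bij_betw h {0..<card I} I" using ex_bij_betw_nat_finite[OF I(1)] by blast
    have h': "h k \<in> I" if "k < card I" for k using h that by (auto simp: bij_betw_def)
    have inj: "h k \<noteq> h k'" if "k < card I" "k' < card I" "k \<noteq> k'" for k k'
      using h that by (auto simp: bij_betw_def inj_on_def)
    have eq: "(\<Sum>i\<in>I. F i) = (\<Sum>k<card I. F (h k))" for F :: "'i \<Rightarrow> real"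
      using sum.reindex_bij_betw[OF h, of F] by (simp add: atLeast0LessThan)
    show "(\<Sum>i\<in>I. norm (f (e i) - f (s i))) < \<epsilon>"
      unfolding eq
    proof (rule d(2), intro conjI allI impI)
      show "(\<Sum>k<card I. e (h k) - s (h k)) < \<delta>" using I(4) unfolding eq .
    qed (use I(2,3) h' inj in blast)+
  qed
qed

text \<open>On a fine tagged division, the intervals tagged outside \<open>N\<close> contribute at most \<open>\<epsilon>\<close> times their
  length, and those tagged in \<open>N\<close> have small total length, so absolute continuity bounds their contribution.\<close>

lemma abs_cont_on_antimono:
  fixes f :: "real \<Rightarrow> real"
  assumes "a \<le> b" and ac: "abs_cont_on a b f" and N: "negligible N"
    and der: "\<And>t. t \<in> {a<..<b} - N \<Longrightarrow> \<exists>D\<le>0. (f has_real_derivative D) (at t)"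
  shows "f b \<le> f a"
proof -
  have main: "f b - f a \<le> \<epsilon> * (b - a) + \<epsilon>" if e: "\<epsilon> > 0" for \<epsilon>
  proof -
    \<comment> \<open>The derivative is controlled only inside the interval, so the endpoints, which
      may occur as tags, join the exceptional set.\<close>
    define M where "M = N \<union> {a, b}"
    have M: "negligible M" unfolding M_def using N by (simp add: negligible_Un)
    obtain \<delta> where d: "\<delta> > 0" "\<forall>(I::(real \<times> real set) set) s e. finite I \<longrightarrow>
      (\<forall>i\<in>I. a \<le> s i \<and> s i \<le> e i \<and> e i \<le> b) \<longrightarrow>
      (\<forall>i\<in>I. \<forall>j\<in>I. i \<noteq> j \<longrightarrow> e i \<le> s j \<or> e j \<le> s i) \<longrightarrow> (\<Sum>i\<in>I. e i - s i) < \<delta> \<longrightarrow>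
      (\<Sum>i\<in>I. norm (f (e i) - f (s i))) < \<epsilon>"
      using abs_cont_on_finite_family[OF ac e, where ?'i="real \<times> real set"] by blast
    have "M \<in> sets lebesgue" using M negligible_imp_sets by blast
    \<comment> \<open>The gauge will keep every interval tagged in \<open>M\<close> inside
      \<open>U\<close>, whose measure is below \<open>\<delta>\<close>.\<close>
    then obtain U where U: "open U" "M \<subseteq> U" "U - M \<in> lmeasurable" "emeasure lebesgue (U - M) < ennreal \<delta>"
      using sets_lebesgue_outer_open d(1) by metis
    have "U = (U - M) \<union> M" using U by auto
    have Um: "U \<in> lmeasurable" using U(3) M \<open>U = _\<close>
      by (metis fmeasurable.Un negligible_iff_measure)
    have "measure lebesgue U \<le> measure lebesgue (U - M) + measure lebesgue M"
      using \<open>U = _\<close> U(3) M by (metis measure_Un_le fmeasurableD negligible_imp_sets)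
    also have "\<dots> < \<delta>"
      using U(3,4) M d(1) by (simp add: emeasure_eq_measure2 negligible_imp_measure0 ennreal_less_iff)
    finally have Ud: "measure lebesgue U < \<delta>" .
    \<comment> \<open>The product form treats both sides of \<open>x\<close> at once: dividing by
      \<open>y - x\<close> bounds the increment from \<open>x\<close> up to \<open>y\<close> if
      \<open>y\<close> lies to the right, and from \<open>y\<close> up to \<open>x\<close> if it
      lies to the left.\<close>
    have "\<exists>r>0. (x \<in> M \<longrightarrow> ball x r \<subseteq> U) \<and>
        (x \<notin> M \<longrightarrow> x \<in> {a..b} \<longrightarrow> (\<forall>y. \<bar>y - x\<bar> < r \<longrightarrow> (y - x) * (f y - f x) \<le> \<epsilon> * (y - x)\<^sup>2))" for x
    proof (cases "x \<in> M \<or> x \<notin> {a..b}")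
      case True
      show ?thesis
      proof (cases "x \<in> M")
        case True
        then show ?thesis using U(1,2) open_contains_ball by blast
      next
        case False
        then show ?thesis using True by (intro exI[of _ 1]) auto
      qed
    next
      case False
      then have "x \<in> {a<..<b} - N" by (auto simp: M_def)
      then obtain D where D: "D \<le> 0" "(f has_real_derivative D) (at x)" using der by blast
      then have "\<exists>r>0. \<forall>y. norm (y - x) < r \<longrightarrow> norm (f y - f x - D * (y - x)) \<le> \<epsilon> * norm (y - x)"
        using e unfolding has_field_derivative_def has_derivative_at_alt by auto
      then obtain r where r: "r > 0" "\<And>y. \<bar>y - x\<bar> < r \<Longrightarrow> \<bar>f y - f x - D * (y - x)\<bar> \<le> \<epsilon> * \<bar>y - x\<bar>"
        by auto
      have "(y - x) * (f y - f x) \<le> \<epsilon> * (y - x)\<^sup>2" if "\<bar>y - x\<bar> < r" for y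
      proof -
        have "(y - x) * (f y - f x) = D * (y - x)\<^sup>2 + (y - x) * (f y - f x - D * (y - x))"
          by (simp add: algebra_simps power2_eq_square)
        also have "\<dots> \<le> 0 + \<bar>y - x\<bar> * \<bar>f y - f x - D * (y - x)\<bar>"
          using D(1) by (intro add_mono) (auto simp: mult_nonpos_nonneg abs_mult[symmetric])
        also have "\<dots> \<le> \<bar>y - x\<bar> * (\<epsilon> * \<bar>y - x\<bar>)"
          using r(2)[OF that] by (simp add: mult_left_mono)
        also have "\<dots> = \<epsilon> * (y - x)\<^sup>2" by (simp add: power2_eq_square)
        finally show ?thesis .
      qed
      then show ?thesis using r(1) False by auto
    qed
    then obtain r where r: "\<And>x. r x > 0" "\<And>x. x \<in> M \<Longrightarrow> ball x (r x) \<subseteq> U"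
      "\<And>x y. x \<notin> M \<Longrightarrow> x \<in> {a..b} \<Longrightarrow> \<bar>y - x\<bar> < r x \<Longrightarrow> (y - x) * (f y - f x) \<le> \<epsilon> * (y - x)\<^sup>2"
      by metis
    have "gauge (\<lambda>x. ball x (r x))" using r(1) by (auto simp: gauge_def)
    then obtain p where p: "p tagged_division_of {a..b}" "(\<lambda>x. ball x (r x)) fine p"
      using fine_division_exists_real by blast
    note pD = tagged_division_ofD[OF p(1)]
    have piece: "\<exists>u v. K = {u..v} \<and> u \<le> x \<and> x \<le> v \<and> a \<le> u \<and> v \<le> b" if "(x, K) \<in> p" for x K
      using pD(2)[OF that] pD(3)[OF that] pD(4)[OF that] by (auto simp: subset_iff)
    have sub: "K \<subseteq> ball x (r x)" if "(x, K) \<in> p" for x K using p(2) that by (auto simp: fine_def)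
    \<comment> \<open>Degenerate intervals contribute nothing, but they may lie inside another
      interval of the division, where the ordering demanded of a family fails; hence the strict
      inequality.\<close>
    define Q where "Q = {i \<in> p. fst i \<in> M \<and> Inf (snd i) < Sup (snd i)}"
    have finp: "finite p" by (rule pD(1))
    have "f b - f a = (\<Sum>(x, K)\<in>p. f (Sup K) - f (Inf K))"
      using additive_tagged_division_1[OF \<open>a \<le> b\<close> p(1), of f] by simp
    also have "\<dots> \<le> (\<Sum>(x, K)\<in>p. \<epsilon> * measure lborel K + (if (x, K) \<in> Q then norm (f (Sup K) - f (Inf K)) else 0))"
    proof (rule sum_mono, clarify)
      fix x K assume xK: "(x, K) \<in> p"
      obtain u v where uv: "K = {u..v}" "u \<le> x" "x \<le> v" "a \<le> u" "v \<le> b" using piece[OF xK] by blast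
      show "f (Sup K) - f (Inf K) \<le> \<epsilon> * measure lborel K + (if (x, K) \<in> Q then norm (f (Sup K) - f (Inf K)) else 0)"
      proof (cases "(x, K) \<in> Q")
        case True
        have "0 \<le> \<epsilon> * measure lborel K" using e by simp
        then show ?thesis using True by (simp add: abs_le_iff)
      next
        case False
        show ?thesis
        proof (cases "u = v")
          case True
          then show ?thesis using False uv e by simp
        next
          case False
          then have xM: "x \<notin> M" using \<open>(x, K) \<notin> Q\<close> xK uv unfolding Q_def by auto
          have xab: "x \<in> {a..b}" using uv by auto
          have "u \<in> K" "v \<in> K" using uv by auto
          then have "u \<in> ball x (r x)" "v \<in> ball x (r x)" using sub[OF xK] by blast+
          then have "\<bar>u - x\<bar> < r x" "\<bar>v - x\<bar> < r x" by (auto simp: dist_real_def)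
          then have 1: "(u - x) * (f u - f x) \<le> \<epsilon> * (u - x)\<^sup>2" "(v - x) * (f v - f x) \<le> \<epsilon> * (v - x)\<^sup>2"
            using r(3) xM xab by auto
          have 2: "f v - f x \<le> \<epsilon> * (v - x)"
          proof (cases "v = x")
            case False
            then have "(v - x) * (f v - f x) \<le> (v - x) * (\<epsilon> * (v - x))" "v - x > 0"
              using 1(2) uv by (auto simp: power2_eq_square algebra_simps)
            then show ?thesis by simp
          qed auto
          have 3: "f x - f u \<le> \<epsilon> * (x - u)"
          proof (cases "u = x")
            case False
            then have "(x - u) * (f x - f u) \<le> (x - u) * (\<epsilon> * (x - u))" "x - u > 0"
              using 1(1) uv by (auto simp: power2_eq_square algebra_simps)
            then show ?thesis by simp
          qed auto
          from 2 3 show ?thesis using uv \<open>(x, K) \<notin> Q\<close> by (simp add: algebra_simps)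
        qed
      qed
    qed
    also have "\<dots> = \<epsilon> * (\<Sum>(x, K)\<in>p. measure lborel K) + (\<Sum>i\<in>Q. norm (f (Sup (snd i)) - f (Inf (snd i))))"
    proof -
      have "Q \<subseteq> p" unfolding Q_def by auto
      then have "(\<Sum>i\<in>p. if i \<in> Q then norm (f (Sup (snd i)) - f (Inf (snd i))) else 0)
        = (\<Sum>i\<in>Q. norm (f (Sup (snd i)) - f (Inf (snd i))))"
        using sum.inter_restrict[OF finp, of "\<lambda>i. norm (f (Sup (snd i)) - f (Inf (snd i)))" Q]
        by (simp add: Int_absorb1)
      then show ?thesis
        by (simp add: split_def sum.distrib sum_distrib_left)
    qed
    also have "(\<Sum>(x, K)\<in>p. measure lborel K) = b - a"
      using additive_content_tagged_division[of p a b] p(1) \<open>a \<le> b\<close> by simp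
    also have "(\<Sum>i\<in>Q. norm (f (Sup (snd i)) - f (Inf (snd i)))) < \<epsilon>"
    proof (rule d(2)[rule_format])
      show "finite Q" using finp unfolding Q_def by auto
      show "a \<le> Inf (snd i) \<and> Inf (snd i) \<le> Sup (snd i) \<and> Sup (snd i) \<le> b" if "i \<in> Q" for i
        using that piece[of "fst i" "snd i"] unfolding Q_def by auto
      show "Sup (snd i) \<le> Inf (snd j) \<or> Sup (snd j) \<le> Inf (snd i)" if "i \<in> Q" "j \<in> Q" "i \<noteq> j" for i j
      proof -
        obtain x K y L where ij: "i = (x, K)" "j = (y, L)" by (cases i, cases j)
        have "(x, K) \<in> p" "(y, L) \<in> p" using that ij unfolding Q_def by auto
        then obtain u v u' v' where uv: "K = {u..v}" "L = {u'..v'}" "u \<le> v" "u' \<le> v'"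
          using piece by (metis order_trans)
        have lt: "u < v" "u' < v'" using that ij uv unfolding Q_def by auto
        have "interior K \<inter> interior L = {}"
          using pD(5)[of x K y L] \<open>(x, K) \<in> p\<close> \<open>(y, L) \<in> p\<close> that(3) ij by blast
        then have "{max u u'<..<min v v'} = {}" using uv by (auto simp: set_eq_iff)
        then have "min v v' \<le> max u u'" by (metis greaterThanLessThan_empty_iff2)
        then show ?thesis using ij uv lt by (auto simp: min_def max_def split: if_splits)
      qed
      have Qt: "Q tagged_partial_division_of {a..b}"
        using p(1) tagged_partial_division_subset[of p "{a..b}" Q]
        unfolding Q_def tagged_division_of_def by auto
      note Qt2 = tagged_partial_division_of_Union_self[OF Qt]
      have "(\<Sum>i\<in>Q. Sup (snd i) - Inf (snd i)) = (\<Sum>(x, K)\<in>Q. measure lborel K)"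
      proof (rule sum.cong)
        fix i assume "i \<in> Q"
        then show "Sup (snd i) - Inf (snd i) = (case i of (x, K) \<Rightarrow> measure lborel K)"
          using piece[of "fst i" "snd i"] unfolding Q_def by (auto simp: split_def)
      qed simp
      also have "\<dots> = (\<Sum>K\<in>snd ` Q. measure lborel K)"
        by (rule sum.over_tagged_division_lemma[OF Qt2]) (simp add: content_eq_0_interior)
      also have "\<dots> = (\<Sum>K\<in>snd ` Q. measure lebesgue K)"
      proof (rule sum.cong)
        fix K assume "K \<in> snd ` Q"
        then obtain u v where "K = {u..v}" using piece unfolding Q_def by force
        then show "measure lborel K = measure lebesgue K" by simp
      qed simp
      also have "\<dots> = measure lebesgue (\<Union>(snd ` Q))"
        using content_division[OF division_of_tagged_division[OF Qt2]] by simp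
      also have "\<dots> \<le> measure lebesgue U"
      proof (rule measure_mono_fmeasurable[OF _ _ Um])
        show "\<Union>(snd ` Q) \<subseteq> U" using sub r(2) unfolding Q_def by fastforce
        show "\<Union>(snd ` Q) \<in> sets lebesgue"
          using division_of_tagged_division[OF Qt2] lmeasurable_division by blast
      qed
      also note Ud
      finally show "(\<Sum>i\<in>Q. Sup (snd i) - Inf (snd i)) < \<delta>" .
    qed
    finally show ?thesis by simp
  qed
  show ?thesis
  proof (rule ccontr)
    assume "\<not> f b \<le> f a"
    then have pos: "f b - f a > 0" by simp
    define c where "c = b - a + 1"
    have c: "c > 0" using \<open>a \<le> b\<close> by (simp add: c_def)
    have "f b - f a \<le> (f b - f a) / (2 * c) * c"
      using main[of "(f b - f a) / (2 * c)"] pos c unfolding c_def distrib_left by simp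
    also have "\<dots> = (f b - f a) / 2" using c by simp
    finally show False using pos by simp
  qed
qed

subsection \<open>Signed powers\<close>

lemma spow_pos: "0 < z \<Longrightarrow> spow z a = z powr a"
  by (auto simp: spow_def)

lemma spow_neg: "z < 0 \<Longrightarrow> spow z a = - ((- z) powr a)"
  by (auto simp: spow_def)

lemma spow_zero: "spow 0 a = 0"
  by (auto simp: spow_def)



lemma sgn_spow: "sgn (spow z a) = sgn z"
  by (cases z "0::real" rule: linorder_cases) (auto simp: spow_pos spow_neg spow_zero)

lemma abs_spow: "0 < a \<Longrightarrow> \<bar>spow z a\<bar> = \<bar>z\<bar> powr a"
  by (cases z "0::real" rule: linorder_cases) (auto simp: spow_pos spow_neg spow_zero)

lemma spow_scale: "0 < l \<Longrightarrow> spow (l * z) a = l powr a * spow z a"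
proof (cases z "0::real" rule: linorder_cases)
  assume l: "0 < l"
  case less
  with l have "spow (l * z) a = - ((l * (- z)) powr a)"
    by (simp add: spow_neg mult_pos_neg)
  also have "\<dots> = - (l powr a * (- z) powr a)" using less l by (subst powr_mult) auto
  finally show ?thesis using less by (simp add: spow_neg)
qed (auto simp: spow_pos spow_zero powr_mult)

lemma spow_spow: "spow (spow z a) b = spow z (a * b)"
  by (cases z "0::real" rule: linorder_cases) (auto simp: spow_pos spow_neg spow_zero powr_powr)

lemma spow_one: "spow z 1 = z"
  by (cases z "0::real" rule: linorder_cases) (auto simp: spow_pos spow_neg spow_zero)

lemma spow_strict_mono:
  assumes "0 < a" "x < y"
  shows "spow x a < spow y a"
proof -
  consider "0 < x" | "x \<le> 0" "0 < y" | "x < 0" "y = 0" | "y < 0"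
    using assms(2) by linarith
  then show ?thesis
  proof cases
    case 2
    have "spow x a \<le> 0" using 2(1) by (cases "x = 0") (auto simp: spow_zero spow_neg)
    then show ?thesis using 2 by (simp add: spow_pos order.strict_trans1)
  next
    case 4
    then show ?thesis using assms powr_less_mono2[of a "- y" "- x"] by (simp add: spow_neg)
  qed (use assms powr_less_mono2[of a x y] in \<open>auto simp: spow_pos spow_neg spow_zero\<close>)
qed

text \<open>At 0 the difference quotient is the power \<open>a - 1\<close> of the absolute value,
  which tends to 0 because \<open>a > 1\<close>. The Lyapunov function applies \<open>spow\<close>
  only with such exponents and is therefore C1.\<close>

lemma DERIV_spow:
  assumes a: "1 < a"
  shows "((\<lambda>z. spow z a) has_real_derivative a * \<bar>z\<bar> powr (a - 1)) (at z)"
proof (cases z "0::real" rule: linorder_cases)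
  case greater
  have "((\<lambda>z. z powr a) has_real_derivative a * \<bar>z\<bar> powr (a - 1)) (at z)"
    using greater by (auto intro!: derivative_eq_intros)
  then show ?thesis
    by (rule DERIV_cong_ev[THEN iffD1, rotated -1])
       (auto simp: spow_pos intro!: eventually_mono[OF eventually_nhds_in_open[of "{0<..}" z]] greater)
next
  case less
  have "((\<lambda>z. - ((- z) powr a)) has_real_derivative a * \<bar>z\<bar> powr (a - 1)) (at z)"
    using less by (auto intro!: derivative_eq_intros)
  then show ?thesis
    by (rule DERIV_cong_ev[THEN iffD1, rotated -1])
       (auto simp: spow_neg intro!: eventually_mono[OF eventually_nhds_in_open[of "{..<0}" z]] less)
next
  case equal
  have "((\<lambda>h. \<bar>h\<bar> powr (a - 1)) \<longlongrightarrow> \<bar>0\<bar> powr (a - 1)) (at (0::real))"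
    by (rule tendsto_powr'[OF tendsto_rabs[OF tendsto_ident_at] tendsto_const]) (use a in auto)
  moreover have "spow h a / h = \<bar>h\<bar> powr (a - 1)" if "h \<noteq> 0" for h
  proof -
    have "spow h a / h = \<bar>h\<bar> powr a / \<bar>h\<bar>"
      using that by (cases h "0::real" rule: linorder_cases) (auto simp: spow_pos spow_neg)
    then show ?thesis using that by (simp add: powr_diff)
  qed
  ultimately have "((\<lambda>h. spow h a / h) \<longlongrightarrow> 0) (at 0)"
    by (auto elim!: Lim_transform_eventually intro: eventually_at_filter[THEN iffD2])
  then show ?thesis using equal a by (simp add: DERIV_def spow_zero)
qed

lemma tendsto_abs_powr:
  fixes f :: "'a \<Rightarrow> real"
  assumes "(f \<longlongrightarrow> l) F" "0 < a"
  shows "((\<lambda>i. \<bar>f i\<bar> powr a) \<longlongrightarrow> \<bar>l\<bar> powr a) F"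
  by (rule tendsto_powr'[OF tendsto_rabs[OF assms(1)] tendsto_const]) (use assms in auto)

lemma tendsto_spow:
  assumes f: "(f \<longlongrightarrow> l) F" and a: "0 < a"
  shows "((\<lambda>i. spow (f i) a) \<longlongrightarrow> spow l a) F"
proof -
  \<comment> \<open>Splitting into positive and negative part avoids a case distinction on the sign
    of the limit.\<close>
  have eq: "spow z a = (max z 0) powr a - (max (- z) 0) powr a" for z
    using a by (cases z "0::real" rule: linorder_cases) (auto simp: spow_pos spow_neg spow_zero)
  show ?thesis unfolding eq
    by (intro tendsto_diff tendsto_powr' tendsto_max tendsto_minus f tendsto_const) (use a in auto)
qed

lemma abs_cont_on_spow:
  fixes f :: "real \<Rightarrow> real"
  assumes f: "abs_cont_on u v f" and a: "1 < a"
  shows "abs_cont_on u v (\<lambda>t. spow (f t) a)"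
proof -
  obtain M where M: "M > 0" "\<And>t. t \<in> {u..v} \<Longrightarrow> norm (f t) \<le> M"
    by (rule abs_cont_on_bounded[OF f], rule that)
  show ?thesis
  proof (rule abs_cont_on_C1_compose[OF f, where S="{-M..M}" and G'="\<lambda>z. a * \<bar>z\<bar> powr (a - 1)"])
    show "f ` {u..v} \<subseteq> {-M..M}" using M(2) by (auto simp: abs_le_iff minus_le_iff)
    show "continuous_on {-M..M} (\<lambda>z. a * \<bar>z\<bar> powr (a - 1))"
      unfolding continuous_on_def using a
      by (intro ballI tendsto_mult tendsto_const tendsto_abs_powr tendsto_ident_at) auto
  qed (auto intro: DERIV_spow a)
qed

subsection \<open>The homogeneous differentiator\<close>

text \<open>The error chain of the differentiator, numbered from the bottom, is
  \<open>x' k = x (k - 1) - c k * spow (x n) ((k - 1) / n)\<close> for \<open>k = 1..n\<close>, where \<open>x 0\<close> is the disturbance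
  and the signed power in the equation for \<open>k = 1\<close> is replaced by a selection \<open>s\<close> of the set-valued sign;
  \<open>x k\<close> has homogeneity weight \<open>k\<close>.\<close>

definition diff_vel :: "(nat \<Rightarrow> real) \<Rightarrow> nat \<Rightarrow> (nat \<Rightarrow> real) \<Rightarrow> real \<Rightarrow> real \<Rightarrow> nat \<Rightarrow> real" where
  "diff_vel c n x y s k = x (k - 1) - c k * (if k = 1 then s else spow y (real (k - 1) / real n))"

text \<open>The exponent lifts the predecessor from weight \<open>k - 1\<close> to weight
  \<open>k\<close>, so the whole is homogeneous of degree \<open>k\<close>. The case
  \<open>k = 1\<close> keeps the disturbance \<open>x 0\<close> out of the Lyapunov
  function.\<close>

definition lyap_arg :: "(nat \<Rightarrow> real) \<Rightarrow> (nat \<Rightarrow> real) \<Rightarrow> nat \<Rightarrow> real" where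
  "lyap_arg N x k = N k * x k - (if k = 1 then 0 else spow (x (k - 1)) (real k / real (k - 1)))"

definition lyap_arg_deriv :: "(nat \<Rightarrow> real) \<Rightarrow> (nat \<Rightarrow> real) \<Rightarrow> (nat \<Rightarrow> real) \<Rightarrow> nat \<Rightarrow> real" where
  "lyap_arg_deriv N x v k = N k * v k -
     (if k = 1 then 0 else real k / real (k - 1) * \<bar>x (k - 1)\<bar> powr (1 / real (k - 1)) * v (k - 1))"

text \<open>Every summand has weight \<open>p\<close>. With \<open>2 * k dvd p\<close> the division
  is exact and the power even, so the terms are nonnegative without absolute values.\<close>

definition lyap :: "nat \<Rightarrow> (nat \<Rightarrow> real) \<Rightarrow> nat \<Rightarrow> (nat \<Rightarrow> real) \<Rightarrow> real" where
  "lyap p N n x = (\<Sum>k=1..n. lyap_arg N x k ^ (p div k))"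

definition lyap_deriv :: "nat \<Rightarrow> (nat \<Rightarrow> real) \<Rightarrow> nat \<Rightarrow> (nat \<Rightarrow> real) \<Rightarrow> (nat \<Rightarrow> real) \<Rightarrow> real" where
  "lyap_deriv p N n x v =
     (\<Sum>k=1..n. real (p div k) * lyap_arg N x k ^ (p div k - 1) * lyap_arg_deriv N x v k)"

lemma exponent_gt_one: "1 < k \<Longrightarrow> 1 < real k / real (k - 1)"
  by (simp add: of_nat_diff)

lemma exponent_minus_one: "1 < k \<Longrightarrow> real k / real (k - 1) - 1 = 1 / real (k - 1)"
  by (simp add: of_nat_diff field_simps)

lemma lyap_arg_has_derivative:
  assumes "k \<ge> 1" "((\<lambda>t. x t k) has_real_derivative v k) (at t)"
    "k > 1 \<Longrightarrow> ((\<lambda>t. x t (k - 1)) has_real_derivative v (k - 1)) (at t)"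
  shows "((\<lambda>t. lyap_arg N (x t) k) has_real_derivative lyap_arg_deriv N (x t) v k) (at t)"
proof (cases "k = 1")
  case True
  then show ?thesis using DERIV_cmult[OF assms(2), of "N k"]
    by (simp add: lyap_arg_def lyap_arg_deriv_def)
next
  case False
  then have k: "k > 1" using assms(1) by simp
  show ?thesis
    using False DERIV_diff[OF DERIV_cmult[OF assms(2), of "N k"]
      DERIV_chain2[OF DERIV_spow[OF exponent_gt_one[OF k]] assms(3)[OF k]]]
    unfolding lyap_arg_def lyap_arg_deriv_def exponent_minus_one[OF k] by simp
qed

lemma lyap_has_derivative:
  assumes "\<And>k. k \<in> {1..n} \<Longrightarrow> ((\<lambda>t. x t k) has_real_derivative v k) (at t)"
  shows "((\<lambda>t. lyap p N n (x t)) has_real_derivative lyap_deriv p N n (x t) v) (at t)"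
  unfolding lyap_def lyap_deriv_def
proof (rule DERIV_sum)
  fix k assume k: "k \<in> {1..n}"
  have "((\<lambda>t. lyap_arg N (x t) k) has_real_derivative lyap_arg_deriv N (x t) v k) (at t)"
    using k by (intro lyap_arg_has_derivative assms) auto
  from DERIV_power[OF this, of "p div k"]
  show "((\<lambda>t. lyap_arg N (x t) k ^ (p div k)) has_real_derivative
    real (p div k) * lyap_arg N (x t) k ^ (p div k - 1) * lyap_arg_deriv N (x t) v k) (at t)"
    by (simp add: mult_ac)
qed

lemma lyap_abs_cont_on:
  assumes "\<And>k. k \<in> {1..n} \<Longrightarrow> abs_cont_on a b (\<lambda>t. x t k)"
  shows "abs_cont_on a b (\<lambda>t. lyap p N n (x t))"
  unfolding lyap_def
proof (intro abs_cont_on_sum abs_cont_on_power)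
  fix k assume k: "k \<in> {1..n}"
  show "abs_cont_on a b (\<lambda>t. lyap_arg N (x t) k)"
  proof (cases "k = 1")
    case True
    then show ?thesis using k assms[of k] by (simp add: lyap_arg_def abs_cont_on_cmult)
  next
    case False
    then have "k > 1" "k - 1 \<in> {1..n}" using k by auto
    then show ?thesis using False k unfolding lyap_arg_def
      by (auto intro!: abs_cont_on_diff abs_cont_on_cmult abs_cont_on_spow assms exponent_gt_one)
  qed
qed

section \<open>Continuity, definiteness and bounded sublevel sets of the Lyapunov function\<close>

lemma tendsto_lyap_arg:
  assumes "k \<ge> 1" "((\<lambda>i. x i k) \<longlongrightarrow> l k) F" "((\<lambda>i. x i (k - 1)) \<longlongrightarrow> l (k - 1)) F"
  shows "((\<lambda>i. lyap_arg N (x i) k) \<longlongrightarrow> lyap_arg N l k) F"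
  unfolding lyap_arg_def using assms
  by (auto intro!: tendsto_intros tendsto_spow)

lemma tendsto_lyap:
  assumes "\<And>k. k \<le> n \<Longrightarrow> ((\<lambda>i. x i k) \<longlongrightarrow> l k) F"
  shows "((\<lambda>i. lyap p N n (x i)) \<longlongrightarrow> lyap p N n l) F"
  unfolding lyap_def
  by (intro tendsto_sum tendsto_power tendsto_lyap_arg assms) auto

lemma tendsto_lyap_deriv:
  assumes "\<And>k. k \<le> n \<Longrightarrow> ((\<lambda>i. x i k) \<longlongrightarrow> l k) F"
    and "\<And>k. 1 \<le> k \<Longrightarrow> k \<le> n \<Longrightarrow> ((\<lambda>i. v i k) \<longlongrightarrow> w k) F"
  shows "((\<lambda>i. lyap_deriv p N n (x i) (v i)) \<longlongrightarrow> lyap_deriv p N n l w) F"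
  unfolding lyap_deriv_def
proof (intro tendsto_sum tendsto_mult tendsto_const tendsto_power tendsto_lyap_arg assms)
  fix k assume k: "k \<in> {1..n}"
  show "((\<lambda>i. lyap_arg_deriv N (x i) (v i) k) \<longlongrightarrow> lyap_arg_deriv N l w k) F"
    unfolding lyap_arg_deriv_def using k
    by (auto intro!: tendsto_intros tendsto_abs_powr assms)
qed auto

lemma tendsto_diff_vel:
  assumes "((\<lambda>i. x i (k - 1)) \<longlongrightarrow> l (k - 1)) F" "(y \<longlongrightarrow> z) F" "(s \<longlongrightarrow> r) F" "1 \<le> k" "1 \<le> n"
  shows "((\<lambda>i. diff_vel c n (x i) (y i) (s i) k) \<longlongrightarrow> diff_vel c n l z r k) F"
  unfolding diff_vel_def using assms by (auto intro!: tendsto_intros tendsto_spow)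

lemma two_dvd_exponent:
  assumes "2 * k dvd p" "0 < p" "(k::nat) \<ge> 1"
  shows "even (p div k)" "p div k \<ge> 2" "k * (p div k) = p"
proof -
  obtain j where j: "p = 2 * k * j" using assms(1) by blast
  then have "p div k = 2 * j" using assms(3) by simp
  moreover have "j > 0" using j assms by (cases j) auto
  ultimately show "even (p div k)" "p div k \<ge> 2" by auto
  show "k * (p div k) = p" using j assms(3) by simp
qed

lemma lyap_term_le:
  assumes p: "0 < p" "\<And>k. k \<in> {1..n} \<Longrightarrow> 2 * k dvd p" and k: "k \<in> {1..n}"
  shows "0 \<le> lyap_arg N x k ^ (p div k)" "lyap_arg N x k ^ (p div k) \<le> lyap p N n x"
proof -
  have *: "0 \<le> lyap_arg N x j ^ (p div j)" if "j \<in> {1..n}" for j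
    using two_dvd_exponent(1)[of j p] p that by (intro zero_le_even_power) auto
  show "0 \<le> lyap_arg N x k ^ (p div k)" by (rule *[OF k])
  show "lyap_arg N x k ^ (p div k) \<le> lyap p N n x"
    unfolding lyap_def using * k by (intro member_le_sum) auto
qed

lemma lyap_nonneg:
  assumes "0 < p" "\<And>k. k \<in> {1..n} \<Longrightarrow> 2 * k dvd p"
  shows "0 \<le> lyap p N n x"
  unfolding lyap_def using lyap_term_le(1)[OF assms] by (intro sum_nonneg) blast

text \<open>All summands vanish, and the coordinates are recovered from the bottom: once
  \<open>x (k - 1) = 0\<close>, the argument of index \<open>k\<close> reduces to
  \<open>N k * x k\<close>.\<close>

lemma lyap_eq_0_imp:
  assumes p: "0 < p" "\<And>k. k \<in> {1..n} \<Longrightarrow> 2 * k dvd p" and N: "\<And>k. k \<in> {1..n} \<Longrightarrow> 0 < N k"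
    and V: "lyap p N n x = 0" and k: "k \<in> {1..n}"
  shows "x k = 0"
proof -
  have w: "lyap_arg N x k = 0" if "k \<in> {1..n}" for k
  proof -
    have "lyap_arg N x k ^ (p div k) = 0"
      using lyap_term_le[OF p that, where N=N and x=x] V by linarith
    then show ?thesis by simp
  qed
  from k show ?thesis
  proof (induction k)
    case (Suc j)
    show ?case
    proof (cases "j = 0")
      case True
      then show ?thesis using w[of "Suc j"] N[of "Suc j"] Suc.prems by (simp add: lyap_arg_def)
    next
      case False
      then have "x j = 0" using Suc by auto
      then show ?thesis using w[of "Suc j"] N[of "Suc j"] Suc.prems False
        by (simp add: lyap_arg_def spow_zero)
    qed
  qed simp
qed

text \<open>The same recursion from the bottom, now with bounds. It supplies the boundedness for the
  compactness argument on the level set.\<close>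

lemma lyap_sublevel_bounded:
  assumes p: "0 < p" "\<And>k. k \<in> {1..n} \<Longrightarrow> 2 * k dvd p" and N: "\<And>k. k \<in> {1..n} \<Longrightarrow> 0 < N k"
    and k: "k \<in> {1..n}"
  shows "\<exists>B. \<forall>x. lyap p N n x \<le> 1 \<longrightarrow> \<bar>x k\<bar> \<le> B"
proof -
  have w: "\<bar>lyap_arg N x k\<bar> \<le> 1" if "k \<in> {1..n}" "lyap p N n x \<le> 1" for k x
  proof -
    have "\<bar>lyap_arg N x k\<bar> ^ (p div k) \<le> 1"
      using lyap_term_le(2)[OF p that(1), where N=N and x=x] that two_dvd_exponent(1)[of k p] p
      by (simp add: power_even_abs)
    then show ?thesis
      using two_dvd_exponent(2)[of k p] p that(1) by (subst (asm) power_le_one_iff) auto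
  qed
  from k show ?thesis
  proof (induction k)
    case (Suc j)
    show ?case
    proof (cases "j = 0")
      case True
      have "\<bar>x (Suc j)\<bar> \<le> 1 / N (Suc j)" if "lyap p N n x \<le> 1" for x
        using w[OF Suc.prems that] N[OF Suc.prems] True
        by (simp add: lyap_arg_def abs_mult field_simps)
      then show ?thesis by blast
    next
      case False
      then obtain B where B: "\<And>x. lyap p N n x \<le> 1 \<Longrightarrow> \<bar>x j\<bar> \<le> B" using Suc by auto
      have "\<bar>x (Suc j)\<bar> \<le> (1 + B powr (real (Suc j) / real j)) / N (Suc j)" if V: "lyap p N n x \<le> 1" for x
      proof -
        have "\<bar>N (Suc j) * x (Suc j)\<bar> \<le> 1 + \<bar>spow (x j) (real (Suc j) / real j)\<bar>"
          using w[OF Suc.prems V] False by (simp add: lyap_arg_def)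
        also have "\<dots> \<le> 1 + B powr (real (Suc j) / real j)"
          using B[OF V] False by (simp add: abs_spow powr_mono2)
        finally show ?thesis using N[OF Suc.prems] by (simp add: abs_mult field_simps)
      qed
      then show ?thesis by blast
    qed
  qed simp
qed

text \<open>Bolzano-Weierstrass for finitely many coordinates, extracting once per coordinate, since
  states are functions on the naturals.\<close>

lemma bounded_family_convergent_subsequence:
  fixes X :: "nat \<Rightarrow> nat \<Rightarrow> real"
  assumes "\<And>k. k < n \<Longrightarrow> \<exists>B. \<forall>i. \<bar>X i k\<bar> \<le> B"
  shows "\<exists>l r. strict_mono r \<and> (\<forall>k<n. (\<lambda>i. X (r i) k) \<longlonglongrightarrow> l k)"
  using assms
proof (induction n)
  case 0
  show ?case by (auto intro: strict_mono_id[unfolded id_def])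
next
  case (Suc n)
  then obtain l r where r: "strict_mono r" "\<And>k. k < n \<Longrightarrow> (\<lambda>i. X (r i) k) \<longlonglongrightarrow> l k"
    by (metis less_SucI)
  obtain B where "\<And>i. \<bar>X i n\<bar> \<le> B" using Suc.prems by blast
  then have "bounded (range (\<lambda>i. X (r i) n))" by (auto simp: bounded_iff)
  then obtain l' r' where r': "strict_mono r'" "((\<lambda>i. X (r i) n) \<circ> r') \<longlonglongrightarrow> l'"
    using bounded_imp_convergent_subsequence by blast
  have "(\<lambda>i. X (r (r' i)) k) \<longlonglongrightarrow> (l(n := l')) k" if "k < Suc n" for k
    using that r' LIMSEQ_subseq_LIMSEQ[OF r(2) r'(1), of k] by (auto simp: o_def less_Suc_eq)
  then show ?case
    using strict_mono_o[OF r(1) r'(1)] unfolding o_def by blast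
qed

section \<open>Homogeneity under the weighted dilation\<close>

lemma real_power_powr_frac:
  assumes "0 < l" "1 \<le> n"
  shows "(l ^ n) powr (real m / real n) = l ^ m"
  using assms by (simp add: powr_realpow[symmetric] powr_powr)

lemma lyap_arg_scale:
  assumes l: "0 < l" and k: "1 \<le> k"
  shows "lyap_arg N (\<lambda>k. l ^ k * x k) k = l ^ k * lyap_arg N x k"
proof (cases "k = 1")
  case False
  then have "spow (l ^ (k - 1) * x (k - 1)) (real k / real (k - 1)) =
    l ^ k * spow (x (k - 1)) (real k / real (k - 1))"
    using l k spow_scale[of "l ^ (k - 1)" "x (k - 1)"] real_power_powr_frac[of l "k - 1" k] by simp
  then show ?thesis using False by (simp add: lyap_arg_def algebra_simps)
qed (simp add: lyap_arg_def)

lemma lyap_scale: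
  assumes "0 < l" "0 < p" "\<And>k. k \<in> {1..n} \<Longrightarrow> 2 * k dvd p"
  shows "lyap p N n (\<lambda>k. l ^ k * x k) = l ^ p * lyap p N n x"
  unfolding lyap_def sum_distrib_left
proof (rule sum.cong)
  fix k assume "k \<in> {1..n}"
  then show "lyap_arg N (\<lambda>k. l ^ k * x k) k ^ (p div k) = l ^ p * lyap_arg N x k ^ (p div k)"
    using assms two_dvd_exponent(3)[of k p]
    by (simp add: lyap_arg_scale power_mult_distrib power_mult[symmetric])
qed simp

text \<open>The vector field has degree -1: component \<open>k\<close> of the velocity has weight
  \<open>k - 1\<close>. For \<open>k = 1\<close> the factor is 1, so neither the disturbance nor
  \<open>s\<close> is rescaled and their bounds survive every dilation.\<close>

lemma diff_vel_scale:
  assumes "0 < l" "1 \<le> k" "k \<le> n"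
  shows "diff_vel c n (\<lambda>k. l ^ k * x k) (l ^ n * y) s k = l ^ (k - 1) * diff_vel c n x y s k"
  using assms spow_scale[of "l ^ n" y "real (k - 1) / real n"] real_power_powr_frac[of l n "k - 1"]
  by (simp add: diff_vel_def right_diff_distrib del: of_nat_diff)

lemma lyap_deriv_scale:
  assumes l: "0 < l" and p: "0 < p" "\<And>k. k \<in> {1..n} \<Longrightarrow> 2 * k dvd p"
    and v: "\<And>k. k \<in> {1..n} \<Longrightarrow> w k = l ^ (k - 1) * v k"
  shows "lyap_deriv p N n (\<lambda>k. l ^ k * x k) w = l ^ (p - 1) * lyap_deriv p N n x v"
  unfolding lyap_deriv_def sum_distrib_left
proof (rule sum.cong)
  fix k assume k: "k \<in> {1..n}"
  note e = two_dvd_exponent[OF p(2)[OF k] p(1)]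
  have d: "lyap_arg_deriv N (\<lambda>k. l ^ k * x k) w k = l ^ (k - 1) * lyap_arg_deriv N x v k"
  proof (cases "k = 1")
    case True
    then show ?thesis using v[OF k] by (simp add: lyap_arg_deriv_def)
  next
    case False
    then obtain j where j: "k = Suc (Suc j)" using k by (cases k; cases "k - 1") auto
    have "\<bar>l ^ Suc j * x (Suc j)\<bar> powr (1 / real (Suc j)) = l * \<bar>x (Suc j)\<bar> powr (1 / real (Suc j))"
      using l real_power_powr_frac[of l "Suc j" 1] by (simp add: abs_mult powr_mult)
    then show ?thesis using v[OF k] v[of "Suc j"] k j
      by (simp add: lyap_arg_deriv_def algebra_simps)
  qed
  \<comment> \<open>Degree count: \<open>p div k - 1\<close> factors of weight \<open>k\<close> and
    one derivative of weight \<open>k - 1\<close>.\<close>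
  have "k * (p div k - 1) + (k - 1) = p - 1"
    using e k by (simp add: right_diff_distrib')
      (metis Nat.add_diff_assoc2 atLeastAtMost_iff diff_add_inverse2 le_add_diff_inverse2 mult_le_mono2 nat_mult_1_right numeral_2_eq_2 Suc_leD One_nat_def)
  then have "(l ^ k) ^ (p div k - 1) * l ^ (k - 1) = l ^ (p - 1)"
    by (metis power_add power_mult)
  then show "real (p div k) * lyap_arg N (\<lambda>k. l ^ k * x k) k ^ (p div k - 1) *
      lyap_arg_deriv N (\<lambda>k. l ^ k * x k) w k =
    l ^ (p - 1) * (real (p div k) * lyap_arg N x k ^ (p div k - 1) * lyap_arg_deriv N x v k)"
    using lyap_arg_scale[OF l, of k N x] k unfolding d by (simp add: power_mult_distrib)
qed simp

lemma lyap_cong: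
  assumes "\<And>k. 1 \<le> k \<Longrightarrow> k \<le> n \<Longrightarrow> N k = N' k" "\<And>k. 1 \<le> k \<Longrightarrow> k \<le> n \<Longrightarrow> x k = y k"
  shows "lyap p N n x = lyap p N' n y"
  unfolding lyap_def lyap_arg_def using assms by (intro sum.cong) auto

lemma lyap_deriv_cong:
  assumes "\<And>k. 1 \<le> k \<Longrightarrow> k \<le> n \<Longrightarrow> N k = N' k" "\<And>k. 1 \<le> k \<Longrightarrow> k \<le> n \<Longrightarrow> x k = y k"
    "\<And>k. 1 \<le> k \<Longrightarrow> k \<le> n \<Longrightarrow> v k = w k"
  shows "lyap_deriv p N n x v = lyap_deriv p N' n y w"
  unfolding lyap_deriv_def lyap_arg_deriv_def lyap_arg_def using assms by (intro sum.cong) auto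

lemma lyap_Suc: "lyap p N (Suc n) x = lyap p N n x + lyap_arg N x (Suc n) ^ (p div Suc n)"
  by (simp add: lyap_def)

lemma lyap_deriv_Suc: "lyap_deriv p N (Suc n) x v = lyap_deriv p N n x v +
    real (p div Suc n) * lyap_arg N x (Suc n) ^ (p div Suc n - 1) * lyap_arg_deriv N x v (Suc n)"
  by (simp add: lyap_deriv_def)

text \<open>The condition \<open>\<bar>s\<bar> \<le> 1\<close>, \<open>s * y = \<bar>y\<bar>\<close> says that \<open>s\<close> belongs to the set-valued sign of \<open>y\<close>.\<close>

definition lyap_decay :: "nat \<Rightarrow> real \<Rightarrow> nat \<Rightarrow> (nat \<Rightarrow> real) \<Rightarrow> (nat \<Rightarrow> real) \<Rightarrow> real \<Rightarrow> bool" where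
  "lyap_decay p L n N c \<epsilon> \<longleftrightarrow> 0 < \<epsilon> \<and> (\<forall>k\<in>{1..n}. 0 < N k \<and> 0 < c k) \<and>
     (\<forall>x s. \<bar>x 0\<bar> \<le> L \<longrightarrow> \<bar>s\<bar> \<le> 1 \<longrightarrow> s * x n = \<bar>x n\<bar> \<longrightarrow> lyap p N n x = 1 \<longrightarrow>
        lyap_deriv p N n x (diff_vel c n x (x n) s) \<le> - \<epsilon>)"

text \<open>On the level set \<open>x 1\<close> is 1 or -1, so the selection is forced to be
  \<open>s = x 1\<close>. The gain \<open>L + 1\<close> then beats the disturbance by a margin of 1,
  which the factor \<open>p\<close> from differentiating the power turns into the rate.\<close>

lemma lyap_decay_base:
  assumes "0 \<le> L" "0 < p" "even p"
  shows "lyap_decay p L 1 (\<lambda>_. 1) (\<lambda>_. L + 1) (real p)"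
  unfolding lyap_decay_def
proof (intro conjI ballI allI impI)
  fix x :: "nat \<Rightarrow> real" and s
  assume d: "\<bar>x 0\<bar> \<le> L" and s: "\<bar>s\<bar> \<le> 1" "s * x 1 = \<bar>x 1\<bar>" and V: "lyap p (\<lambda>_. 1) 1 x = 1"
  have "x 1 ^ p = 1" using V by (simp add: lyap_def lyap_arg_def)
  then have "\<bar>x 1\<bar> ^ p = 1" using assms by (simp add: power_even_abs)
  then have "\<bar>x 1\<bar> = 1" using assms by (metis abs_ge_zero power_eq_1_iff neq0_conv abs_idempotent real_norm_def)
  then have x1: "x 1 = s" "s * s = 1" using s by (auto simp: abs_if split: if_splits)
  obtain j where "p - 1 = Suc (2 * j)" using assms by (cases p) (auto elim!: oddE)
  then have "s ^ (p - 1) = s" using x1(2) by (simp add: power_mult power2_eq_square)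
  then have "lyap_deriv p (\<lambda>_. 1) 1 x (diff_vel (\<lambda>_. L + 1) 1 x (x 1) s) = real p * s * (x 0 - (L + 1) * s)"
    using x1 by (simp add: lyap_deriv_def lyap_arg_def lyap_arg_deriv_def diff_vel_def)
  also have "\<dots> = real p * (s * x 0 - (L + 1) * (s * s))" by (simp add: algebra_simps)
  also have "s * x 0 \<le> L"
    using d s(1) mult_mono[of "\<bar>s\<bar>" 1 "\<bar>x 0\<bar>" L] by (auto simp: abs_mult[symmetric])
  then have "real p * (s * x 0 - (L + 1) * (s * s)) \<le> real p * (- 1)"
    using x1 by (intro mult_left_mono) auto
  finally show "lyap_deriv p (\<lambda>_. 1) 1 x (diff_vel (\<lambda>_. L + 1) 1 x (x 1) s) \<le> - real p" by simp
qed (use assms in auto)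

text \<open>In the coordinates \<open>X = x(n + 1 := K * x (n + 1))\<close> the new Lyapunov function does not depend on
  \<open>K\<close>, and its derivative is \<open>A X s - K * G X\<close> with \<open>G X \<ge> 0\<close>. Where \<open>G X = 0\<close>, the first
  \<open>n\<close> equations are those of the chain of order \<open>n\<close>, so \<open>A X s \<le> - \<epsilon>\<close> there; compactness of the
  level set yields a \<open>K\<close> for which the derivative is negative on all of it.\<close>

lemma lyap_decay_step:
  assumes n: "1 \<le> n" and p: "0 < p" "\<And>k. k \<in> {1..Suc n} \<Longrightarrow> 2 * k dvd p"
    and dec: "lyap_decay p L n N c \<epsilon>"
  shows "\<exists>N' c' \<epsilon>'. lyap_decay p L (Suc n) N' c' \<epsilon>'"
proof -
  define m where "m = p div Suc n"
  define a where "a = real (Suc n) / real n"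
  define b where "b = real n / real (Suc n)"
  define N1 where "N1 = N(Suc n := 1)"
  define c1 where "c1 = c(Suc n := 1)"
  define w where "w X = X (Suc n) - spow (X n) a" for X :: "nat \<Rightarrow> real"
  define v where "v X s = diff_vel c1 (Suc n) X (X (Suc n)) s" for X s
  define A where "A X s = lyap_deriv p N n X (v X s) -
    real m * w X ^ (m - 1) * (a * \<bar>X n\<bar> powr (1 / real n) * v X s n)" for X s
  \<comment> \<open>This comes from the top equation: the velocity of \<open>X (Suc n)\<close> is
    \<open>K * (X n - spow (X (Suc n)) b)\<close>, and it enters with the outer derivative
    \<open>m * w X ^ (m - 1)\<close>. Everything else is in \<open>A\<close>.\<close>
  define G where "G X = real m * w X ^ (m - 1) * (spow (X (Suc n)) b - X n)" for X
  define adm where "adm X s \<longleftrightarrow> \<bar>X 0\<bar> \<le> L \<and> \<bar>s\<bar> \<le> 1 \<and> s * X (Suc n) = \<bar>X (Suc n)\<bar> \<and>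
    lyap p N1 (Suc n) X = 1" for X s
  have \<epsilon>: "0 < \<epsilon>" and pos: "\<And>k. k \<in> {1..n} \<Longrightarrow> 0 < N k \<and> 0 < c k"
    and old: "\<And>x s. \<bar>x 0\<bar> \<le> L \<Longrightarrow> \<bar>s\<bar> \<le> 1 \<Longrightarrow> s * x n = \<bar>x n\<bar> \<Longrightarrow> lyap p N n x = 1 \<Longrightarrow>
        lyap_deriv p N n x (diff_vel c n x (x n) s) \<le> - \<epsilon>"
    using dec unfolding lyap_decay_def by blast+
  have ab: "0 < a" "0 < b" "a * b = 1" using n by (simp_all add: a_def b_def)
  have m: "even m" "2 \<le> m" using two_dvd_exponent[OF p(2)[of "Suc n"] p(1)] unfolding m_def by auto
  have N1: "\<And>k. k \<in> {1..Suc n} \<Longrightarrow> 0 < N1 k" using pos by (auto simp: N1_def)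
  have lyapX: "lyap p N1 (Suc n) X = lyap p N n X + w X ^ m" for X
  proof -
    have "lyap p N1 n X = lyap p N n X" by (rule lyap_cong) (auto simp: N1_def)
    then show ?thesis using n by (simp add: lyap_Suc lyap_arg_def N1_def w_def m_def a_def)
  qed
  have oddm: "odd (m - 1)" using m by simp
  \<comment> \<open>As \<open>b\<close> is the inverse of \<open>a\<close>, applying
    \<open>spow\<close> with exponent \<open>b\<close> shows that the second factor has the sign of
    \<open>w X\<close>; so has the odd power.\<close>
  have Gpos: "0 < G X" if "w X \<noteq> 0" for X
  proof (cases "0 < w X")
    case True
    then have "spow (spow (X n) a) b < spow (X (Suc n)) b"
      by (intro spow_strict_mono ab) (simp add: w_def)
    then have "X n < spow (X (Suc n)) b" by (simp add: spow_spow ab spow_one)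
    then show ?thesis using True m unfolding G_def by simp
  next
    case False
    then have neg: "w X < 0" using that by simp
    then have "spow (X (Suc n)) b < spow (spow (X n) a) b"
      by (intro spow_strict_mono ab) (simp add: w_def)
    then have "spow (X (Suc n)) b < X n" by (simp add: spow_spow ab spow_one)
    moreover have "w X ^ (m - 1) < 0" using neg oddm by (simp add: power_less_zero_eq)
    ultimately have "0 < w X ^ (m - 1) * (spow (X (Suc n)) b - X n)" by (simp add: mult_neg_neg)
    then show ?thesis using m unfolding G_def by (simp add: mult.assoc)
  qed
  have G0: "G X = 0" if "w X = 0" for X using that m by (simp add: G_def)
  have A_on_zero: "A X s \<le> - \<epsilon>" if X: "adm X s" "w X = 0" for X s
  proof -
    have y: "X (Suc n) = spow (X n) a" using X(2) by (simp add: w_def)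
    have "A X s = lyap_deriv p N n X (v X s)" using X(2) m by (simp add: A_def)
    also have "\<dots> = lyap_deriv p N n X (diff_vel c n X (X n) s)"
    proof (rule lyap_deriv_cong)
      fix k assume k: "1 \<le> k" "k \<le> n"
      \<comment> \<open>On \<open>w X = 0\<close> the injected coordinate is
        \<open>spow (X n) a\<close>, and \<open>a\<close> turns the exponents of order
        \<open>n + 1\<close> into those of order \<open>n\<close>. Signs are preserved as well, so
        \<open>s\<close> remains a selection for \<open>X n\<close>.\<close>
      have "a * (real (k - 1) / real (Suc n)) = real (k - 1) / real n"
        using n by (simp add: a_def)
      then show "v X s k = diff_vel c n X (X n) s k"
        using k by (simp add: v_def diff_vel_def c1_def y spow_spow del: of_nat_diff of_nat_Suc)
    qed auto
    also have "\<dots> \<le> - \<epsilon>"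
    proof (rule old)
      show "lyap p N n X = 1" using X m lyapX[of X] by (simp add: adm_def power_0_left)
      have "sgn (X (Suc n)) = sgn (X n)" unfolding y by (rule sgn_spow)
      moreover have "s * X (Suc n) = sgn (X (Suc n)) * X (Suc n)"
        using X(1) unfolding adm_def by (simp add: abs_sgn mult.commute)
      ultimately have "X n = 0 \<or> s = sgn (X n)"
        by (cases "X (Suc n) = 0") (auto simp: sgn_zero_iff)
      then show "s * X n = \<bar>X n\<bar>" by (auto simp: abs_sgn)
    qed (use X in \<open>auto simp: adm_def\<close>)
    finally show ?thesis .
  qed
  \<comment> \<open>If no \<open>K\<close> works, take a violation for each
    \<open>K = Suc i\<close>. A limit point is admissible, has \<open>G\<close> equal to 0 and
    \<open>A\<close> at least \<open>- \<epsilon> / 2\<close>, against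
    \<open>A_on_zero\<close>.\<close>
  obtain K where K: "0 < K" "\<And>X s. adm X s \<Longrightarrow> A X s - K * G X \<le> - \<epsilon> / 2"
  proof (rule ccontr)
    assume no: "\<not> thesis"
    have "\<exists>X s. adm X s \<and> - \<epsilon> / 2 < A X s - real (Suc i) * G X" for i
      using no that[of "real (Suc i)"] by (metis linorder_not_le of_nat_0_less_iff zero_less_Suc)
    then obtain X s where Xs: "\<And>i. adm (X i) (s i)"
      "\<And>i. - \<epsilon> / 2 < A (X i) (s i) - real (Suc i) * G (X i)" by metis
    \<comment> \<open>The selection is stored in a spare coordinate, so that one subsequence serves
      both state and selection.\<close>
    define Y where "Y i k = (if k = Suc (Suc n) then s i else X i k)" for i k
    have "\<exists>B. \<forall>i. \<bar>Y i k\<bar> \<le> B" if k: "k < Suc (Suc (Suc n))" for k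
    proof -
      consider "k = Suc (Suc n)" | "k = 0" | "k \<in> {1..Suc n}" using k by force
      then show ?thesis
      proof cases
        case 3
        have "\<exists>B. \<forall>x. lyap p N1 (Suc n) x \<le> 1 \<longrightarrow> \<bar>x k\<bar> \<le> B"
          by (rule lyap_sublevel_bounded[OF p(1) _ _ 3]) (use p(2) N1 in blast)+
        then obtain B where "\<And>x. lyap p N1 (Suc n) x \<le> 1 \<Longrightarrow> \<bar>x k\<bar> \<le> B" by blast
        then show ?thesis using 3 Xs(1) unfolding Y_def adm_def by (intro exI[of _ B]) auto
      qed (use Xs(1) in \<open>auto simp: Y_def adm_def\<close>)
    qed
    then obtain l r where r: "strict_mono r"
      "\<And>k. k < Suc (Suc (Suc n)) \<Longrightarrow> (\<lambda>i. Y (r i) k) \<longlonglongrightarrow> l k"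
      using bounded_family_convergent_subsequence[of "Suc (Suc (Suc n))" Y] by metis
    have X: "(\<lambda>i. X (r i) k) \<longlonglongrightarrow> l k" if "k \<le> Suc n" for k
      using r(2)[of k] that by (simp add: Y_def)
    define s0 where "s0 = l (Suc (Suc n))"
    have s: "(\<lambda>i. s (r i)) \<longlonglongrightarrow> s0"
      using r(2)[of "Suc (Suc n)"] by (simp add: Y_def s0_def)
    have adm0: "adm l s0"
      unfolding adm_def
    proof (intro conjI)
      show "\<bar>l 0\<bar> \<le> L"
        by (rule LIMSEQ_le_const2[OF tendsto_rabs[OF X[of 0]]]) (use Xs(1) in \<open>auto simp: adm_def\<close>)
      show "\<bar>s0\<bar> \<le> 1"
        by (rule LIMSEQ_le_const2[OF tendsto_rabs[OF s]]) (use Xs(1) in \<open>auto simp: adm_def\<close>)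
      have "(\<lambda>i. s (r i) * X (r i) (Suc n)) \<longlonglongrightarrow> s0 * l (Suc n)"
        by (intro tendsto_mult s X) simp
      moreover have "(\<lambda>i. s (r i) * X (r i) (Suc n)) \<longlonglongrightarrow> \<bar>l (Suc n)\<bar>"
        using tendsto_rabs[OF X[of "Suc n"]] Xs(1) by (simp add: adm_def)
      ultimately show "s0 * l (Suc n) = \<bar>l (Suc n)\<bar>" by (rule LIMSEQ_unique)
      have "(\<lambda>i. lyap p N1 (Suc n) (X (r i))) \<longlonglongrightarrow> lyap p N1 (Suc n) l"
        by (intro tendsto_lyap X)
      moreover have "(\<lambda>i. lyap p N1 (Suc n) (X (r i))) \<longlonglongrightarrow> 1"
        using Xs(1) by (simp add: adm_def)
      ultimately show "lyap p N1 (Suc n) l = 1" by (rule LIMSEQ_unique)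
    qed
    have limw: "(\<lambda>i. w (X (r i))) \<longlonglongrightarrow> w l"
      unfolding w_def by (intro tendsto_diff tendsto_spow X ab) auto
    have limv: "(\<lambda>i. v (X (r i)) (s (r i)) k) \<longlonglongrightarrow> v l s0 k" if "1 \<le> k" "k \<le> n" for k
      unfolding v_def using that by (intro tendsto_diff_vel X s) auto
    have limA: "(\<lambda>i. A (X (r i)) (s (r i))) \<longlonglongrightarrow> A l s0"
      unfolding A_def
      by (intro tendsto_diff tendsto_mult tendsto_const tendsto_power tendsto_lyap_deriv
          tendsto_abs_powr limw limv X) (use n in auto)
    have limG: "(\<lambda>i. G (X (r i))) \<longlonglongrightarrow> G l"
      unfolding G_def
      by (intro tendsto_diff tendsto_mult tendsto_const tendsto_power tendsto_spow limw X ab) auto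
    have Gnn: "0 \<le> G X" for X using Gpos[of X] G0[of X] by (cases "w X = 0") auto
    have "A (X i) (s i) \<ge> - \<epsilon> / 2" for i
      using Xs(2)[of i] Gnn[of "X i"] by (smt (verit) mult_nonneg_nonneg of_nat_0_le_iff)
    then have A0: "A l s0 \<ge> - \<epsilon> / 2" by (intro LIMSEQ_le_const[OF limA]) auto
    \<comment> \<open>Dividing the violated inequality by \<open>Suc i\<close> leaves an upper bound
      for \<open>G\<close> that tends to 0, because \<open>A\<close> converges along the
      subsequence.\<close>
    have "(\<lambda>i. (A (X (r i)) (s (r i)) + \<epsilon> / 2) * inverse (real (Suc (r i)))) \<longlonglongrightarrow> (A l s0 + \<epsilon> / 2) * 0"
      using LIMSEQ_subseq_LIMSEQ[OF LIMSEQ_inverse_real_of_nat r(1)]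
      by (intro tendsto_mult tendsto_add limA tendsto_const) (simp add: o_def)
    moreover have "G (X i) \<le> (A (X i) (s i) + \<epsilon> / 2) * inverse (real (Suc i))" for i
    proof -
      have "real (Suc i) * G (X i) \<le> A (X i) (s i) + \<epsilon> / 2" using Xs(2)[of i] by simp
      then show ?thesis by (simp add: field_simps del: of_nat_Suc)
    qed
    ultimately have "G l \<le> 0" using LIMSEQ_le[OF limG, of _ "(A l s0 + \<epsilon> / 2) * 0"] by auto
    then have "w l = 0" using Gpos[of l] by linarith
    then show False using A_on_zero[OF adm0] A0 \<epsilon> by simp
  qed
  define N' where "N' = N(Suc n := K)"
  \<comment> \<open>Scaling the top coordinate by \<open>K\<close> multiplies its signed powers by
    these powers of \<open>K\<close>; the gains absorb them. For \<open>k = 1\<close> the factor is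
    1, as befits the sign term.\<close>
  define c' where "c' k = c1 k * K powr (real (k - 1) / real (Suc n))" for k
  have "lyap_decay p L (Suc n) N' c' (\<epsilon> / 2)"
    unfolding lyap_decay_def
  proof (intro conjI ballI allI impI)
    fix x :: "nat \<Rightarrow> real" and s
    assume d: "\<bar>x 0\<bar> \<le> L" and s: "\<bar>s\<bar> \<le> 1" "s * x (Suc n) = \<bar>x (Suc n)\<bar>"
      and V: "lyap p N' (Suc n) x = 1"
    define X where "X = x(Suc n := K * x (Suc n))"
    have Xk: "X k = x k" if "k \<le> n" for k using that by (simp add: X_def)
    have vel: "diff_vel c' (Suc n) x (x (Suc n)) s k = v X s k" if "1 \<le> k" "k \<le> Suc n" for k
      using that K(1) Xk[of "k - 1"]
      by (auto simp: diff_vel_def v_def c'_def X_def spow_scale simp del: of_nat_diff of_nat_Suc)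
    have "lyap p N' n x = lyap p N n X" by (rule lyap_cong) (auto simp: N'_def X_def)
    then have V': "lyap p N' (Suc n) x = lyap p N1 (Suc n) X"
      using n unfolding lyapX by (simp add: lyap_Suc lyap_arg_def N'_def w_def m_def a_def X_def)
    have "adm X s"
      using d s V V' K(1) by (simp add: adm_def X_def abs_mult)
    have E1: "lyap_deriv p N' n x (diff_vel c' (Suc n) x (x (Suc n)) s) = lyap_deriv p N n X (v X s)"
      by (rule lyap_deriv_cong) (use vel in \<open>auto simp: N'_def X_def\<close>)
    have E2: "lyap_arg N' x (Suc n) = w X"
      using n by (simp add: lyap_arg_def N'_def w_def X_def a_def)
    have E3: "lyap_arg_deriv N' x (diff_vel c' (Suc n) x (x (Suc n)) s) (Suc n) =
      K * (X n - spow (X (Suc n)) b) - a * \<bar>X n\<bar> powr (1 / real n) * v X s n"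
    proof -
      have "v X s (Suc n) = X n - spow (X (Suc n)) b"
        using n by (simp add: v_def diff_vel_def c1_def b_def)
      then show ?thesis
        using n vel[of n] vel[of "Suc n"] Xk[of n] by (simp add: lyap_arg_deriv_def N'_def a_def)
    qed
    have "lyap_deriv p N' (Suc n) x (diff_vel c' (Suc n) x (x (Suc n)) s) = A X s - K * G X"
      unfolding lyap_deriv_Suc E1 E2 E3 A_def G_def m_def by (simp add: algebra_simps)
    then show "lyap_deriv p N' (Suc n) x (diff_vel c' (Suc n) x (x (Suc n)) s) \<le> - (\<epsilon> / 2)"
      using K(2)[OF \<open>adm X s\<close>] by simp
  qed (use \<epsilon> pos K(1) in \<open>auto simp: N'_def c'_def c1_def\<close>)
  then show ?thesis by blast
qed

lemma lyap_decay_exists: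
  assumes L: "0 \<le> L" and p: "0 < p" "\<And>k. k \<in> {1..n} \<Longrightarrow> 2 * k dvd p" and n: "1 \<le> n"
  shows "\<exists>N c \<epsilon>. lyap_decay p L n N c \<epsilon>"
  using n p(2)
proof (induction n rule: dec_induct)
  case base
  then have "even p" by simp
  then show ?case using lyap_decay_base[OF L p(1)] by blast
next
  case (step n)
  then obtain N c \<epsilon> where "lyap_decay p L n N c \<epsilon>" by fastforce
  then show ?case
    using step.hyps(1) step.prems p(1) by (intro lyap_decay_step[of n p L N c \<epsilon>]) simp_all
qed

text \<open>Dilation by the inverse of \<open>r\<close> carries the state to the unit level set,
  where \<open>lyap_decay\<close> applies; the derivative has degree \<open>p - 1\<close>.\<close>

lemma lyap_decay_homogeneous:
  assumes p: "0 < p" "\<And>k. k \<in> {1..n} \<Longrightarrow> 2 * k dvd p" and n: "1 \<le> n"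
    and dec: "lyap_decay p L n N c \<epsilon>"
    and x: "\<bar>x 0\<bar> \<le> L" "\<bar>s\<bar> \<le> 1" "s * x n = \<bar>x n\<bar>"
    and r: "0 < r" "lyap p N n x = r ^ p"
  shows "lyap_deriv p N n x (diff_vel c n x (x n) s) \<le> - \<epsilon> * r ^ (p - 1)"
proof -
  define l where "l = inverse r"
  have l: "0 < l" "l ^ k * r ^ k = 1" for k
    using r(1) by (simp_all add: l_def power_mult_distrib[symmetric])
  define X where "X = (\<lambda>k. l ^ k * x k)"
  have "lyap_deriv p N n X (diff_vel c n X (X n) s) \<le> - \<epsilon>"
  proof -
    have "lyap p N n X = 1"
      using lyap_scale[OF l(1) p, where N=N and x=x] r(2) l(2)[of p] by (simp add: X_def)
    moreover have "s * X n = \<bar>X n\<bar>" using x(3) l(1) by (simp add: X_def abs_mult)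
    moreover have "\<bar>X 0\<bar> \<le> L" using x(1) by (simp add: X_def)
    ultimately show ?thesis using dec x(2) unfolding lyap_decay_def by blast
  qed
  also have "lyap_deriv p N n X (diff_vel c n X (X n) s) =
      l ^ (p - 1) * lyap_deriv p N n x (diff_vel c n x (x n) s)"
    unfolding X_def
    by (rule lyap_deriv_scale[OF l(1) p], assumption, rule diff_vel_scale) (use l in auto)
  finally have "r ^ (p - 1) * (l ^ (p - 1) * lyap_deriv p N n x (diff_vel c n x (x n) s)) \<le> r ^ (p - 1) * (- \<epsilon>)"
    using r(1) by (intro mult_left_mono) auto
  moreover have *: "r ^ (p - 1) * (l ^ (p - 1) * z) = z" for z
    using l(2)[of "p - 1"] by (metis mult.assoc mult.commute mult_1)
  ultimately show ?thesis unfolding * by (metis mult.commute)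
qed

text \<open>Covers the level 0, which no dilation reaches: each exponent \<open>p div k - 1\<close>
  is at least 1, so a vanishing factor survives differentiation.\<close>

lemma lyap_deriv_eq_0:
  assumes p: "0 < p" "\<And>k. k \<in> {1..n} \<Longrightarrow> 2 * k dvd p" and V: "lyap p N n x = 0"
  shows "lyap_deriv p N n x v = 0"
  unfolding lyap_deriv_def
proof (rule sum.neutral, rule ballI)
  fix k assume k: "k \<in> {1..n}"
  note e = two_dvd_exponent[OF p(2)[OF k] p(1)]
  have "lyap_arg N x k ^ (p div k) = 0"
    using lyap_term_le[OF p k, where N=N and x=x] V by linarith
  then show "real (p div k) * lyap_arg N x k ^ (p div k - 1) * lyap_arg_deriv N x v k = 0"
    using e k by simp
qed

text \<open>The start \<open>T0\<close> is arbitrary because in the application the disturbance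
  obeys its bound only after the transients of the other errors. The selection \<open>s\<close> is
  an arbitrary function of time, so that it can be chosen pointwise.\<close>

definition finite_time_gains :: "nat \<Rightarrow> real \<Rightarrow> (nat \<Rightarrow> real) \<Rightarrow> bool" where
  "finite_time_gains q L c \<longleftrightarrow> (\<forall>k\<in>{1..q}. 0 < c k) \<and>
    (\<forall>(x :: real \<Rightarrow> nat \<Rightarrow> real) s M T0. negligible M \<longrightarrow>
       (\<forall>k\<in>{1..q}. \<forall>T\<ge>T0. abs_cont_on T0 T (\<lambda>t. x t k)) \<longrightarrow>
       (\<forall>t>T0. t \<notin> M \<longrightarrow> \<bar>x t 0\<bar> \<le> L \<and> \<bar>s t\<bar> \<le> 1 \<and> s t * x t q = \<bar>x t q\<bar> \<and>
          (\<forall>k\<in>{1..q}. ((\<lambda>t. x t k) has_real_derivative diff_vel c q (x t) (x t q) (s t) k) (at t))) \<longrightarrow>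
       (\<exists>Tf. \<forall>t\<ge>Tf. \<forall>k\<in>{1..q}. x t k = 0))"

theorem finite_time_gains_exist:
  assumes q: "1 \<le> q" and L: "0 \<le> L"
  shows "\<exists>c. finite_time_gains q L c"
proof -
  \<comment> \<open>One degree must serve all orders up to \<open>q\<close>, since each induction
    step extends the previous Lyapunov function; the factorial makes \<open>2 * k\<close> divide it
    for all of them.\<close>
  define p :: nat where "p = 2 * fact q"
  have p: "0 < p" "\<And>k. k \<in> {1..q} \<Longrightarrow> 2 * k dvd p"
    by (auto simp: p_def dvd_fact)
  obtain N c \<epsilon> where dec: "lyap_decay p L q N c \<epsilon>"
    using lyap_decay_exists[OF L p q] by blast
  have \<epsilon>: "0 < \<epsilon>" and pos: "\<And>k. k \<in> {1..q} \<Longrightarrow> 0 < N k \<and> 0 < c k"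
    using dec unfolding lyap_decay_def by blast+
  show ?thesis
    unfolding finite_time_gains_def
  proof (intro exI[of _ c] conjI allI impI)
    show "\<forall>k\<in>{1..q}. 0 < c k" using pos by blast
    fix x :: "real \<Rightarrow> nat \<Rightarrow> real" and s :: "real \<Rightarrow> real" and M and T0 :: real
    assume M: "negligible M" and ac: "\<forall>k\<in>{1..q}. \<forall>T\<ge>T0. abs_cont_on T0 T (\<lambda>t. x t k)"
      and ode: "\<forall>t>T0. t \<notin> M \<longrightarrow> \<bar>x t 0\<bar> \<le> L \<and> \<bar>s t\<bar> \<le> 1 \<and> s t * x t q = \<bar>x t q\<bar> \<and>
          (\<forall>k\<in>{1..q}. ((\<lambda>t. x t k) has_real_derivative diff_vel c q (x t) (x t q) (s t) k) (at t))"
    define V where "V t = lyap p N q (x t)" for t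
    define D where "D t = lyap_deriv p N q (x t) (diff_vel c q (x t) (x t q) (s t))" for t
    have Vnn: "0 \<le> V t" for t unfolding V_def by (rule lyap_nonneg[OF p])
    have Vac: "abs_cont_on a b V" if "T0 \<le> a" "a \<le> b" for a b
    proof (rule abs_cont_on_subset[OF _ that(1) order_refl])
      show "abs_cont_on T0 b V" unfolding V_def
        using ac that by (intro lyap_abs_cont_on) auto
    qed
    have VD: "(V has_real_derivative D t) (at t)" if "t > T0" "t \<notin> M" for t
      unfolding V_def D_def by (rule lyap_has_derivative) (use ode that in blast)
    have Dle: "D t \<le> - \<epsilon> * r ^ (p - 1)" if "t > T0" "t \<notin> M" "0 < r" "V t = r ^ p" for t r
      unfolding D_def
      by (rule lyap_decay_homogeneous[OF p q dec]) (use ode that in \<open>auto simp: V_def\<close>)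
    have D0: "D t \<le> 0" if t: "t > T0" "t \<notin> M" for t
    proof (cases "V t = 0")
      case True
      then show ?thesis using lyap_deriv_eq_0[OF p] unfolding V_def D_def by simp
    next
      case False
      then have "0 < V t" using Vnn[of t] by simp
      then have "V t = root p (V t) ^ p" "0 < root p (V t)" using p(1) by simp_all
      with Dle[OF t this(2,1)] \<epsilon> show ?thesis
        by (smt (verit) mult_minus_left mult_nonneg_nonneg zero_le_power)
    qed
    have mono: "V b \<le> V a" if "T0 \<le> a" "a \<le> b" for a b
    proof (rule abs_cont_on_antimono[OF that(2) Vac[OF that] M])
      fix t assume "t \<in> {a<..<b} - M"
      then show "\<exists>D\<le>0. (V has_real_derivative D) (at t)" using that VD[of t] D0[of t] by auto
    qed
    have "\<exists>t1\<ge>T0. V t1 = 0"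
    proof (rule ccontr)
      assume "\<not> ?thesis"
      then have Vpos: "0 < V t" if "t \<ge> T0" for t using that Vnn[of t] by force
      \<comment> \<open>If \<open>V\<close> never vanished, its root of order \<open>p\<close> would
        fall at rate at least \<open>\<epsilon> / p\<close>; by this time its initial value would be
        used up.\<close>
      define T where "T = T0 + (real p / \<epsilon>) * (V T0 powr (1 / real p))"
      define g where "g t = V t powr (1 / real p) + \<epsilon> / real p * t" for t
      have T: "T0 \<le> T" using \<epsilon> p(1) by (simp add: T_def)
      have "g T \<le> g T0"
      proof (rule abs_cont_on_antimono[OF T _ M])
        have "abs_cont_on T0 T (\<lambda>t. V t powr (1 / real p))"
        proof (rule abs_cont_on_C1_compose[OF Vac[OF order_refl T], where S="{V T..V T0}"
              and G'="\<lambda>z. 1 / real p * z powr (1 / real p - 1)"])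
          show "V ` {T0..T} \<subseteq> {V T..V T0}" using mono by auto
          \<comment> \<open>The root is C1 only away from 0; monotonicity and the assumption that
            \<open>V\<close> never vanishes keep the values on the interval at or above
            \<open>V T > 0\<close>.\<close>
          have Vp: "0 < z" if "z \<in> {V T..V T0}" for z using that Vpos[OF T] by auto
          show "((\<lambda>z. z powr (1 / real p)) has_real_derivative 1 / real p * z powr (1 / real p - 1)) (at z)"
            if "z \<in> {V T..V T0}" for z
            using Vp[OF that] by (auto intro!: derivative_eq_intros)
          show "continuous_on {V T..V T0} (\<lambda>z. 1 / real p * z powr (1 / real p - 1))"
            using Vp by (intro continuous_intros) force
        qed auto
        then show "abs_cont_on T0 T g" unfolding g_def
          by (intro abs_cont_on_add abs_cont_on_cmult abs_cont_on_ident)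
      next
        fix t assume "t \<in> {T0<..<T} - M"
        then have t: "t > T0" "t \<notin> M" by auto
        have Vt: "0 < V t" using Vpos[of t] t by simp
        define r where "r = V t powr (1 / real p)"
        have r: "0 < r" "V t = r ^ p" using Vt p(1) by (simp_all add: r_def powr_power)
        have "(g has_real_derivative 1 / real p * V t powr (1 / real p - 1) * D t + \<epsilon> / real p) (at t)"
          unfolding g_def using VD[OF t] Vt p(1) by (auto intro!: derivative_eq_intros)
        moreover have "1 / real p * V t powr (1 / real p - 1) * D t + \<epsilon> / real p \<le> 0"
        proof -
          have e: "V t powr (1 / real p - 1) * r ^ (p - 1) = 1"
          proof -
            have "r ^ (p - 1) = V t powr ((real p - 1) / real p)"
              using Vt p(1) by (simp add: r_def powr_power of_nat_diff)
            then show ?thesis using Vt p(1) by (simp add: powr_add[symmetric] field_simps)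
          qed
          have "1 / real p * V t powr (1 / real p - 1) * D t \<le>
              1 / real p * V t powr (1 / real p - 1) * (- \<epsilon> * r ^ (p - 1))"
            using Dle[OF t r] by (intro mult_left_mono) auto
          also have "\<dots> = - \<epsilon> / real p * (V t powr (1 / real p - 1) * r ^ (p - 1))" by simp
          finally show ?thesis unfolding e by simp
        qed
        ultimately show "\<exists>D\<le>0. (g has_real_derivative D) (at t)" by blast
      qed
      then have "V T powr (1 / real p) + \<epsilon> / real p * (T - T0) \<le> V T0 powr (1 / real p)"
        unfolding g_def right_diff_distrib by linarith
      moreover have "\<epsilon> / real p * (T - T0) = V T0 powr (1 / real p)"
        using \<epsilon> p(1) by (simp add: T_def)
      ultimately have "V T powr (1 / real p) \<le> 0" by simp
      then show False using Vpos[OF T] by simp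
    qed
    then obtain t1 where t1: "t1 \<ge> T0" "V t1 = 0" by blast
    show "\<exists>Tf. \<forall>t\<ge>Tf. \<forall>k\<in>{1..q}. x t k = 0"
    proof (intro exI[of _ t1] allI impI ballI)
      fix t k assume t: "t1 \<le> t" and k: "k \<in> {1..q}"
      have "V t = 0" using mono[OF t1(1) t] t1(2) Vnn[of t] by simp
      then have "lyap p N q (x t) = 0" unfolding V_def .
      show "x t k = 0"
        by (rule lyap_eq_0_imp[OF p(1) _ _ \<open>lyap p N q (x t) = 0\<close> k]) (use p(2) pos in blast)+
    qed
  qed
qed

subsection \<open>Asymptotic stability of Hurwitz systems\<close>

text \<open>Confines the matrix type to one proof. In the coordinates given by \<open>Q\<close> the
  system becomes triangular, and the last clause says that the diagonal consists of eigenvalues of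
  \<open>A\<close>, in the form in which \<open>hurwitz\<close> speaks of them.\<close>

lemma schur_triangularization:
  fixes A :: "nat \<Rightarrow> nat \<Rightarrow> complex"
  shows "\<exists>P Q B. (\<forall>i<n. \<forall>k<n. (\<Sum>j<n. Q i j * A j k) = (\<Sum>j<n. B i j * Q j k)) \<and>
    (\<forall>i<n. \<forall>k<n. (\<Sum>j<n. P i j * Q j k) = (if i = k then 1 else 0)) \<and>
    (\<forall>i<n. \<forall>j<i. B i j = 0) \<and>
    (\<forall>i<n. \<exists>v. (\<exists>k<n. v k \<noteq> 0) \<and> (\<forall>r<n. (\<Sum>j<n. A r j * v j) = B i i * v r))"
proof -
  define M where "M = mat n n (\<lambda>(i, j). A i j)"
  have M: "M \<in> carrier_mat n n" by (simp add: M_def)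
  obtain es where es: "char_poly M = (\<Prod>a\<leftarrow>es. [:- a, 1:])"
    using char_poly_factorized[OF M] by blast
  obtain B where B: "B \<in> carrier_mat n n" "upper_triangular B" "similar_mat M B"
    using schur_decomposition_exists[OF M es] by blast
  then obtain P Q where PQ: "similar_mat_wit M B P Q" unfolding similar_mat_def by blast
  note w = similar_mat_witD2[OF M PQ]
  have "Q * M = Q * (P * (B * Q))" using assoc_mult_mat[OF w(6) B(1) w(7)] w(3) by simp
  also have "\<dots> = (Q * P) * (B * Q)"
    using assoc_mult_mat[OF w(7,6) mult_carrier_mat[OF B(1) w(7)]] by simp
  also have "\<dots> = B * Q" unfolding w(2) by (rule left_mult_one_mat[OF mult_carrier_mat[OF B(1) w(7)]])
  finally have QM: "Q * M = B * Q" .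
  have entry: "(X * Y) $$ (i, k) = (\<Sum>j<n. X $$ (i, j) * Y $$ (j, k))"
    if "X \<in> carrier_mat n n" "Y \<in> carrier_mat n n" "i < n" "k < n" for X Y :: "complex mat" and i k
    using that by (simp add: scalar_prod_def atLeast0LessThan)
  show ?thesis
  proof (rule exI[of _ "\<lambda>i j. P $$ (i, j)"], rule exI[of _ "\<lambda>i j. Q $$ (i, j)"],
      rule exI[of _ "\<lambda>i j. B $$ (i, j)"], intro conjI allI impI)
    fix i k assume ik: "i < n" "k < n"
    have "(\<Sum>j<n. Q $$ (i, j) * A j k) = (Q * M) $$ (i, k)"
      using ik entry[OF w(7) M ik] by (simp add: M_def)
    then show "(\<Sum>j<n. Q $$ (i, j) * A j k) = (\<Sum>j<n. B $$ (i, j) * Q $$ (j, k))"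
      unfolding QM entry[OF B(1) w(7) ik] .
    show "(\<Sum>j<n. P $$ (i, j) * Q $$ (j, k)) = (if i = k then 1 else 0)"
      using entry[OF w(6,7) ik] w(1) ik by simp
  next
    fix i j assume "i < n" "j < i"
    then show "B $$ (i, j) = 0" using B unfolding upper_triangular_def by auto
  next
    fix i assume i: "i < n"
    \<comment> \<open>The diagonal entries are the roots of the characteristic polynomial of the
      triangular matrix, which similarity identifies with that of \<open>M\<close>.\<close>
    have "char_poly M = char_poly B" by (rule char_poly_similar[OF B(3)])
    also have "\<dots> = (\<Prod>a\<leftarrow>diag_mat B. [:- a, 1:])" by (rule char_poly_upper_triangular[OF B(1,2)])
    finally have "poly (char_poly M) (B $$ (i, i)) = 0"
      using B(1) i by (auto simp: poly_prod_list prod_list_zero_iff diag_mat_def)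
    then obtain v where v: "eigenvector M v (B $$ (i, i))"
      using eigenvalue_root_char_poly[OF M] unfolding eigenvalue_def by blast
    then have dv: "dim_vec v = n" and v0: "v \<noteq> 0\<^sub>v n" and eq: "M *\<^sub>v v = B $$ (i, i) \<cdot>\<^sub>v v"
      using M unfolding eigenvector_def by auto
    show "\<exists>v. (\<exists>k<n. v k \<noteq> 0) \<and> (\<forall>r<n. (\<Sum>j<n. A r j * v j) = B $$ (i, i) * v r)"
    proof (intro exI[of _ "vec_index v"] conjI allI impI)
      show "\<exists>k<n. vec_index v k \<noteq> 0" using v0 dv by (metis eq_vecI index_zero_vec)
      fix r assume r: "r < n"
      have "vec_index (M *\<^sub>v v) r = (\<Sum>j<n. A r j * vec_index v j)"
        using r dv by (simp add: M_def scalar_prod_def atLeast0LessThan)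
      then show "(\<Sum>j<n. A r j * vec_index v j) = B $$ (i, i) * vec_index v r"
        using r dv eq by simp
    qed
  qed
qed

text \<open>With \<open>a = - Re lam\<close>, Young's inequality gives r' <= - a r + |g|^2 / a for
  the squared modulus r, so r eventually falls below any positive level as g tends to 0.\<close>

lemma scalar_stable_tendsto_0:
  fixes y g :: "real \<Rightarrow> complex"
  assumes ac: "\<And>T. T \<ge> 0 \<Longrightarrow> abs_cont_on 0 T y" and M: "negligible M"
    and der: "\<And>t. t > 0 \<Longrightarrow> t \<notin> M \<Longrightarrow> (y has_vector_derivative (lam * y t + g t)) (at t)"
    and lam: "Re lam < 0" and g: "(g \<longlongrightarrow> 0) at_top"
  shows "(y \<longlongrightarrow> 0) at_top"
proof -
  define a where "a = - Re lam"
  have a: "0 < a" using lam by (simp add: a_def)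
  define r where "r t = (Re (y t))\<^sup>2 + (Im (y t))\<^sup>2" for t
  have r: "r t = (cmod (y t))\<^sup>2" for t by (simp add: r_def cmod_power2)
  have "\<forall>\<^sub>F t in at_top. r t < \<eta>" if \<eta>: "0 < \<eta>" for \<eta>
  proof -
    have "((\<lambda>t. (cmod (g t))\<^sup>2) \<longlongrightarrow> (cmod 0)\<^sup>2) at_top"
      by (intro tendsto_power tendsto_norm g)
    then have "\<forall>\<^sub>F t in at_top. (cmod (g t))\<^sup>2 < a\<^sup>2 * \<eta> / 2"
      by (rule order_tendstoD) (use a \<eta> in simp)
    then obtain T1 where T1: "\<And>t. t \<ge> T1 \<Longrightarrow> (cmod (g t))\<^sup>2 < a\<^sup>2 * \<eta> / 2"
      unfolding eventually_at_top_linorder by blast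
    define T where "T = max T1 0"
    \<comment> \<open>\<open>exp (a * t)\<close> is the integrating factor for r' <= - a (r - \<eta>
      / 2), which holds once |g|^2 < a^2 \<eta> / 2, that is, from \<open>T1\<close> on.\<close>
    define h where "h t = (r t - \<eta> / 2) * exp (a * t)" for t
    have hle: "h b \<le> h T" if b: "T \<le> b" for b
    proof (rule abs_cont_on_antimono[OF b _ M])
      have "abs_cont_on 0 b y" using ac b by (simp add: T_def)
      then have yac: "abs_cont_on T b y" by (rule abs_cont_on_subset) (auto simp: T_def)
      have "abs_cont_on T b (\<lambda>t. exp (a * t))"
        by (rule abs_cont_on_C1_compose[OF abs_cont_on_ident, where S="{T..b}" and G'="\<lambda>t. a * exp (a * t)"])
           (auto intro!: derivative_eq_intros continuous_intros)
      then show "abs_cont_on T b h"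
        unfolding h_def r_def
        by (intro abs_cont_on_mult abs_cont_on_diff abs_cont_on_add abs_cont_on_power abs_cont_on_const
            abs_cont_on_bounded_linear[OF yac] bounded_linear_Re bounded_linear_Im)
    next
      fix t assume "t \<in> {T<..<b} - M"
      then have t: "t > 0" "t \<notin> M" "t \<ge> T1" by (auto simp: T_def)
      define d where "d = lam * y t + g t"
      have yd: "(y has_vector_derivative d) (at t)" using der t unfolding d_def by blast
      have re: "((\<lambda>t. Re (y t)) has_real_derivative Re d) (at t)"
        using bounded_linear.has_vector_derivative[OF bounded_linear_Re yd]
        by (simp add: has_real_derivative_iff_has_vector_derivative)
      have im: "((\<lambda>t. Im (y t)) has_real_derivative Im d) (at t)"
        using bounded_linear.has_vector_derivative[OF bounded_linear_Im yd]
        by (simp add: has_real_derivative_iff_has_vector_derivative)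
      define D where "D = 2 * (Re (y t) * Re d + Im (y t) * Im d)"
      have rd: "(r has_real_derivative D) (at t)"
        using DERIV_add[OF DERIV_power[OF re, of 2] DERIV_power[OF im, of 2]]
        unfolding r_def D_def by (simp add: algebra_simps)
      have "(h has_real_derivative (D + a * (r t - \<eta> / 2)) * exp (a * t)) (at t)"
        unfolding h_def by (auto intro!: derivative_eq_intros rd simp: algebra_simps)
      moreover have "D + a * (r t - \<eta> / 2) \<le> 0"
      proof -
        have "D = 2 * Re (cnj (y t) * d)" by (simp add: D_def)
        also have "cnj (y t) * d = lam * (y t * cnj (y t)) + cnj (y t) * g t"
          by (simp add: d_def algebra_simps)
        also have "y t * cnj (y t) = complex_of_real (r t)"
          unfolding r using complex_norm_square by metis
        also have "Re (lam * complex_of_real (r t) + cnj (y t) * g t) \<le> - a * r t + cmod (y t) * cmod (g t)"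
          using complex_Re_le_cmod[of "cnj (y t) * g t"] by (simp add: a_def norm_mult)
        finally have "D \<le> - 2 * a * r t + 2 * (cmod (y t) * cmod (g t))" by simp
        moreover have "2 * (cmod (y t) * cmod (g t)) \<le> a * r t + (cmod (g t))\<^sup>2 / a"
        proof -
          have "0 \<le> (a * cmod (y t) - cmod (g t))\<^sup>2 / a" using a by simp
          also have "\<dots> = a * r t + (cmod (g t))\<^sup>2 / a - 2 * (cmod (y t) * cmod (g t))"
            using a by (simp add: r power2_eq_square field_simps)
          finally show ?thesis by simp
        qed
        moreover have "(cmod (g t))\<^sup>2 / a \<le> a * \<eta> / 2"
          using T1[OF t(3)] a by (simp add: field_simps power2_eq_square)
        ultimately show ?thesis by (simp add: algebra_simps)
      qed
      ultimately show "\<exists>D\<le>0. (h has_real_derivative D) (at t)"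
        by (meson exp_ge_zero mult_nonpos_nonneg)
    qed
    have "((\<lambda>t. \<eta> / 2 + h T * exp (- (a * t))) \<longlongrightarrow> \<eta> / 2 + h T * 0) at_top"
    proof (intro tendsto_add tendsto_mult tendsto_const)
      have "filterlim (\<lambda>t. a * t) at_top at_top"
        using a by (intro filterlim_tendsto_pos_mult_at_top[OF tendsto_const]) (auto simp: filterlim_ident)
      then show "((\<lambda>t. exp (- (a * t))) \<longlongrightarrow> 0) at_top"
        by (intro filterlim_compose[OF exp_at_bot] filterlim_compose[OF filterlim_uminus_at_bot_at_top])
    qed
    then have "\<forall>\<^sub>F t in at_top. \<eta> / 2 + h T * exp (- (a * t)) < \<eta>"
      by (rule order_tendstoD) (use \<eta> in simp)
    then show ?thesis using eventually_ge_at_top[of T]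
    proof eventually_elim
      case (elim t)
      have "r t - \<eta> / 2 = h t * exp (- (a * t))" by (simp add: h_def exp_minus field_simps)
      also have "\<dots> \<le> h T * exp (- (a * t))" using hle[OF elim(2)] by simp
      finally show ?case using elim(1) by simp
    qed
  qed
  then have ev: "\<forall>\<^sub>F t in at_top. r t < e\<^sup>2" if "0 < e" for e using that by simp
  show ?thesis
  proof (rule tendstoI)
    fix e :: real assume e: "0 < e"
    from ev[OF e] show "\<forall>\<^sub>F t in at_top. dist (y t) 0 < e"
      by eventually_elim (use e in \<open>auto simp: r intro: power2_less_imp_less\<close>)
  qed
qed

lemma hurwitz_tendsto_0:
  fixes e :: "real \<Rightarrow> nat \<Rightarrow> real"
  assumes A: "hurwitz n A" and ac: "\<And>i T. i < n \<Longrightarrow> T \<ge> 0 \<Longrightarrow> abs_cont_on 0 T (\<lambda>t. e t i)"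
    and M: "negligible M"
    and der: "\<And>t i. t > 0 \<Longrightarrow> t \<notin> M \<Longrightarrow> i < n \<Longrightarrow>
      ((\<lambda>t. e t i) has_real_derivative (\<Sum>j<n. A i j * e t j)) (at t)"
    and i: "i < n"
  shows "((\<lambda>t. e t i) \<longlongrightarrow> 0) at_top"
proof -
  obtain P Q B where QA: "\<forall>i<n. \<forall>k<n. (\<Sum>j<n. Q i j * complex_of_real (A j k)) = (\<Sum>j<n. B i j * Q j k)"
    and PQ: "\<forall>i<n. \<forall>k<n. (\<Sum>j<n. P i j * Q j k) = (if i = k then 1 else 0)"
    and tri: "\<forall>i<n. \<forall>j<i. B i j = 0"
    and ev: "\<forall>i<n. \<exists>v. (\<exists>k<n. v k \<noteq> 0) \<and> (\<forall>r<n. (\<Sum>j<n. complex_of_real (A r j) * v j) = B i i * v r)"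
    using schur_triangularization[of n "\<lambda>i j. complex_of_real (A i j)"] by (elim exE conjE)
  have stable: "Re (B i i) < 0" if "i < n" for i
    using A ev[rule_format, OF that] unfolding hurwitz_def by blast
  define y where "y t i = (\<Sum>j<n. Q i j * complex_of_real (e t j))" for t i
  have yac: "abs_cont_on 0 T (\<lambda>t. y t i)" if "T \<ge> 0" for T i
    unfolding y_def using that
    by (intro abs_cont_on_sum abs_cont_on_cmult abs_cont_on_bounded_linear[OF ac] bounded_linear_of_real) auto
  have yder: "((\<lambda>t. y t i) has_vector_derivative (B i i * y t i + (\<Sum>j=Suc i..<n. B i j * y t j))) (at t)"
    if t: "t > 0" "t \<notin> M" and i: "i < n" for t i
  proof -
    have "((\<lambda>t. y t i) has_vector_derivative (\<Sum>j<n. Q i j * complex_of_real (\<Sum>k<n. A j k * e t k))) (at t)"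
      unfolding y_def
    proof (intro has_vector_derivative_sum has_vector_derivative_mult_right)
      fix j assume "j \<in> {..<n}"
      then have "((\<lambda>t. e t j) has_vector_derivative (\<Sum>k<n. A j k * e t k)) (at t)"
        using der[OF t, of j] by (simp add: has_real_derivative_iff_has_vector_derivative)
      then show "((\<lambda>t. complex_of_real (e t j)) has_vector_derivative complex_of_real (\<Sum>k<n. A j k * e t k)) (at t)"
        by (rule bounded_linear.has_vector_derivative[OF bounded_linear_of_real])
    qed
    also have "(\<Sum>j<n. Q i j * complex_of_real (\<Sum>k<n. A j k * e t k)) =
        (\<Sum>j<n. \<Sum>k<n. Q i j * complex_of_real (A j k) * complex_of_real (e t k))"
      by (simp add: sum_distrib_left mult.assoc)
    also have "\<dots> = (\<Sum>k<n. (\<Sum>j<n. Q i j * complex_of_real (A j k)) * complex_of_real (e t k))"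
      by (subst sum.swap) (simp add: sum_distrib_right)
    also have "\<dots> = (\<Sum>k<n. (\<Sum>j<n. B i j * Q j k) * complex_of_real (e t k))"
      using QA i by simp
    also have "\<dots> = (\<Sum>k<n. \<Sum>j<n. B i j * (Q j k * complex_of_real (e t k)))"
      by (simp add: sum_distrib_right mult.assoc)
    also have "\<dots> = (\<Sum>j<n. B i j * y t j)"
      unfolding y_def by (subst sum.swap) (simp add: sum_distrib_left)
    also have "\<dots> = (\<Sum>j\<in>{i..<n}. B i j * y t j)"
      by (rule sum.mono_neutral_right) (use tri i in auto)
    also have "\<dots> = B i i * y t i + (\<Sum>j=Suc i..<n. B i j * y t j)"
      using i by (rule sum.atLeast_Suc_lessThan)
    finally show ?thesis .
  qed
  \<comment> \<open>Back substitution from the last row upwards: the forcing term of row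
    \<open>i\<close> consists of rows already known to tend to 0.\<close>
  have y0: "((\<lambda>t. y t i) \<longlongrightarrow> 0) at_top" if "i < n" for i
    using that
  proof (induction "n - i" arbitrary: i rule: less_induct)
    case less
    have "((\<lambda>t. \<Sum>j=Suc i..<n. B i j * y t j) \<longlongrightarrow> (\<Sum>j=Suc i..<n. B i j * 0)) at_top"
      by (intro tendsto_sum tendsto_mult tendsto_const less.hyps) (use less.prems in auto)
    then have g: "((\<lambda>t. \<Sum>j=Suc i..<n. B i j * y t j) \<longlongrightarrow> 0) at_top" by simp
    show ?case
      by (rule scalar_stable_tendsto_0[OF yac M yder stable g]) (use less.prems in auto)
  qed
  have "complex_of_real (e t i) = (\<Sum>j<n. P i j * y t j)" for t
  proof -
    have "(\<Sum>j<n. P i j * y t j) = (\<Sum>j<n. \<Sum>k<n. P i j * Q j k * complex_of_real (e t k))"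
      by (simp add: y_def sum_distrib_left mult.assoc)
    also have "\<dots> = (\<Sum>k<n. (\<Sum>j<n. P i j * Q j k) * complex_of_real (e t k))"
      by (subst sum.swap) (simp add: sum_distrib_right)
    also have "\<dots> = (\<Sum>k<n. if k = i then complex_of_real (e t k) else 0)"
      using PQ i by (intro sum.cong) auto
    also have "\<dots> = complex_of_real (e t i)" using i by simp
    finally show ?thesis by simp
  qed
  moreover have "((\<lambda>t. \<Sum>j<n. P i j * y t j) \<longlongrightarrow> (\<Sum>j<n. P i j * 0)) at_top"
    by (intro tendsto_sum tendsto_mult tendsto_const y0) auto
  ultimately have "((\<lambda>t. complex_of_real (e t i)) \<longlongrightarrow> complex_of_real 0) at_top" by simp
  then show ?thesis by (simp only: tendsto_of_real_iff)
qed

subsection \<open>Linear functionals of Filippov velocities\<close>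

text \<open>A half-space is closed and convex, so it contains the closed convex hull as soon as it
  contains the values. The bound holds on the whole ball, hence the empty null set suffices.\<close>

lemma filippov_set_functional_le:
  fixes \<phi> :: "'a::euclidean_space \<Rightarrow> real"
  assumes d: "d \<in> filippov_set f x" and \<phi>: "bounded_linear \<phi>" and "0 < \<delta>"
    and le: "\<And>w. w \<in> ball x \<delta> \<Longrightarrow> \<phi> (f w) \<le> C"
  shows "\<phi> d \<le> C"
proof -
  interpret bounded_linear \<phi> by fact
  have "d \<in> closure (convex hull (f ` (ball x \<delta> - {})))"
    using d \<open>0 < \<delta>\<close> unfolding filippov_set_def by blast
  moreover have "closure (convex hull (f ` (ball x \<delta> - {}))) \<subseteq> {y. \<phi> y \<le> C}"
  proof (intro closure_minimal hull_minimal)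
    show "f ` (ball x \<delta> - {}) \<subseteq> {y. \<phi> y \<le> C}" using le by auto
    show "convex {y. \<phi> y \<le> C}"
    proof (rule convexI)
      fix y z :: 'a and u v :: real
      assume "y \<in> {y. \<phi> y \<le> C}" "z \<in> {y. \<phi> y \<le> C}" and uv: "0 \<le> u" "0 \<le> v" "u + v = 1"
      then show "u *\<^sub>R y + v *\<^sub>R z \<in> {y. \<phi> y \<le> C}"
        using convex_bound_le[of "\<phi> y" C "\<phi> z" u v] by (simp add: add scaleR)
    qed
    show "closed {y. \<phi> y \<le> C}"
      by (intro closed_Collect_le continuous_on continuous_intros)
  qed
  ultimately show ?thesis by blast
qed

lemma filippov_set_functional_limsup:
  fixes \<phi> \<psi> :: "'a::euclidean_space \<Rightarrow> real"
  assumes d: "d \<in> filippov_set f x" and \<phi>: "bounded_linear \<phi>" and \<psi>: "isCont \<psi> x"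
    and le: "\<forall>\<^sub>F w in nhds x. \<phi> (f w) \<le> \<psi> w"
  shows "\<phi> d \<le> \<psi> x"
proof (rule field_le_epsilon)
  fix \<epsilon> :: real assume "0 < \<epsilon>"
  have "(\<psi> \<longlongrightarrow> \<psi> x) (nhds x)" using \<psi> by (simp add: isCont_def tendsto_at_iff_tendsto_nhds)
  then have "\<forall>\<^sub>F w in nhds x. \<psi> w < \<psi> x + \<epsilon>"
    by (rule order_tendstoD) (use \<open>0 < \<epsilon>\<close> in simp)
  with le have "\<forall>\<^sub>F w in nhds x. \<phi> (f w) \<le> \<psi> x + \<epsilon>" by eventually_elim simp
  then obtain \<delta> where "0 < \<delta>" "\<And>w. dist w x < \<delta> \<Longrightarrow> \<phi> (f w) \<le> \<psi> x + \<epsilon>"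
    unfolding eventually_nhds_metric by blast
  then show "\<phi> d \<le> \<psi> x + \<epsilon>"
    by (intro filippov_set_functional_le[OF d \<phi>, of \<delta>]) (auto simp: dist_commute)
qed

text \<open>The regularization does not alter a component that is continuous near \<open>x\<close>,
  even if \<open>f\<close> jumps there in other components.\<close>

lemma filippov_set_functional_eq:
  fixes \<phi> \<psi> :: "'a::euclidean_space \<Rightarrow> real"
  assumes d: "d \<in> filippov_set f x" and \<phi>: "bounded_linear \<phi>" and \<psi>: "isCont \<psi> x"
    and eq: "\<forall>\<^sub>F w in nhds x. \<phi> (f w) = \<psi> w"
  shows "\<phi> d = \<psi> x"
proof (rule antisym)
  show "\<phi> d \<le> \<psi> x"
    by (rule filippov_set_functional_limsup[OF d \<phi> \<psi>]) (use eq in eventually_elim, simp)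
  have "- \<phi> d \<le> - \<psi> x"
    by (rule filippov_set_functional_limsup[OF d bounded_linear_minus[OF \<phi>], where \<psi>="\<lambda>w. - \<psi> w"])
       (use \<psi> eq in \<open>auto elim: eventually_mono\<close>)
  then show "\<psi> x \<le> \<phi> d" by simp
qed

text \<open>\<open>s\<close> is found by solving the last equation for it. Bounding the functional
  from both sides gives \<open>\<bar>s\<bar> \<le> 1\<close>, and where \<open>\<eta> x\<close> is
  nonzero the sign is locally constant, which forces \<open>s\<close> to equal it.\<close>

lemma filippov_set_functional_sgn:
  fixes \<phi> \<psi> \<eta> :: "'a::euclidean_space \<Rightarrow> real"
  assumes d: "d \<in> filippov_set f x" and \<phi>: "bounded_linear \<phi>" and \<psi>: "isCont \<psi> x" and \<eta>: "isCont \<eta> x"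
    and c: "0 < c" and eq: "\<And>w. \<phi> (f w) = \<psi> w - c * sgn (\<eta> w)"
  obtains s where "\<bar>s\<bar> \<le> 1" "s * \<eta> x = \<bar>\<eta> x\<bar>" "\<phi> d = \<psi> x - c * s"
proof -
  define s where "s = (\<psi> x - \<phi> d) / c"
  have s: "\<phi> d = \<psi> x - c * s" using c by (simp add: s_def)
  have sgn_le: "c * sgn r \<le> c" "- c \<le> c * sgn r" for r :: real using c by (auto simp: sgn_if)
  have "\<phi> d \<le> \<psi> x + c"
    by (rule filippov_set_functional_limsup[OF d \<phi>, where \<psi>="\<lambda>w. \<psi> w + c"])
       (use \<psi> sgn_le in \<open>auto simp: eq intro!: always_eventually continuous_intros\<close>, smt (verit) sgn_le)
  moreover have "- \<phi> d \<le> - \<psi> x + c"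
    by (rule filippov_set_functional_limsup[OF d bounded_linear_minus[OF \<phi>], where \<psi>="\<lambda>w. - \<psi> w + c"])
       (use \<psi> sgn_le in \<open>auto simp: eq intro!: always_eventually continuous_intros\<close>)
  ultimately have "\<bar>c * s\<bar> \<le> c * 1" using s by simp
  then have s1: "\<bar>s\<bar> \<le> 1" using c by (simp add: abs_mult)
  have lim: "(\<eta> \<longlongrightarrow> \<eta> x) (nhds x)"
    using \<eta> by (simp add: isCont_def tendsto_at_iff_tendsto_nhds)
  have "s * \<eta> x = \<bar>\<eta> x\<bar>"
  proof (cases "\<eta> x" "0::real" rule: linorder_cases)
    case less
    have "\<forall>\<^sub>F w in nhds x. \<eta> w < 0" using order_tendstoD(2)[OF lim less] .
    then have "\<forall>\<^sub>F w in nhds x. \<phi> (f w) = \<psi> w + c" by eventually_elim (simp add: eq)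
    then have "\<phi> d = \<psi> x + c"
      by (intro filippov_set_functional_eq[OF d \<phi>, where \<psi>="\<lambda>w. \<psi> w + c"] continuous_intros \<psi>)
    then have "c * s = c * (- 1)" using s by simp
    then have "s = - 1" using c mult_left_cancel[of c s "- 1"] by simp
    then show ?thesis using less by simp
  next
    case greater
    have "\<forall>\<^sub>F w in nhds x. \<eta> w > 0" using order_tendstoD(1)[OF lim greater] .
    then have "\<forall>\<^sub>F w in nhds x. \<phi> (f w) = \<psi> w - c" by eventually_elim (simp add: eq)
    then have "\<phi> d = \<psi> x - c"
      by (intro filippov_set_functional_eq[OF d \<phi>, where \<psi>="\<lambda>w. \<psi> w - c"] continuous_intros \<psi>)
    then have "s = 1" using s c by simp
    then show ?thesis using greater by simp
  qed simp
  then show thesis using that s1 s by blast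
qed

subsection \<open>Error dynamics\<close>

lemma dec_enc:
  assumes "bij_betw \<iota> {..<N} UNIV" "k < N"
  shows "dec \<iota> (enc \<iota> N v) k = v k"
  using assms by (simp add: dec_def enc_def bij_betw_def inv_into_f_f)

text \<open>This and the next two maps are linear in \<open>v\<close>: applied to a state they give
  the estimation error, applied to a velocity its derivative.\<close>

definition err_a :: "scb_sys \<Rightarrow> (nat \<Rightarrow> real) \<Rightarrow> nat \<Rightarrow> real" where
  "err_a S v k = v k - v (off_ha S + k)"

definition err_b :: "scb_sys \<Rightarrow> (nat \<Rightarrow> real) \<Rightarrow> nat \<Rightarrow> real" where
  "err_b S v k = v (na S + k) - v (off_hb S + k)"

definition err_d :: "scb_sys \<Rightarrow> (nat \<Rightarrow> real) \<Rightarrow> nat \<Rightarrow> real" where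
  "err_d S v k = v (off_xd S + k) - v (off_hd S + k)"

lemma mv_diff: "mv A n v i - mv A n w i = mv A n (\<lambda>k. v k - w k) i"
  by (simp add: mv_def right_diff_distrib sum_subtractf)

lemma mv_mm: "mv (mm A m B) n v i = mv A m (mv B n v) i"
proof -
  have "mv (mm A m B) n v i = (\<Sum>j<n. \<Sum>k<m. A i k * (B k j * v j))"
    by (simp add: mv_def mm_def sum_distrib_right mult.assoc)
  also have "\<dots> = (\<Sum>k<m. \<Sum>j<n. A i k * (B k j * v j))" by (rule sum.swap)
  finally show ?thesis by (simp add: mv_def sum_distrib_left)
qed

lemma mv_add_mat: "mv (\<lambda>r c. A r c + B r c) n v i = mv A n v i + mv B n v i"
  by (simp add: mv_def distrib_right sum.distrib)

lemma mv_diff_mat: "mv (\<lambda>r c. A r c - B r c) n v i = mv A n v i - mv B n v i"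
  by (simp add: mv_def left_diff_distrib sum_subtractf)

lemma err_a_rhs:
  assumes "i < na S"
  shows "err_a S (cl_rhs S Lb \<kappa> u0 ud t v) i = mv (Aa S) (na S) (err_a S v) i"
  using assms
  by (simp add: err_a_def[abs_def] cl_rhs_def Let_def cat_def off_ha_def mv_diff[symmetric] sub_def)

lemma err_b_rhs:
  assumes "i < nb S"
  shows "err_b S (cl_rhs S Lb \<kappa> u0 ud t v) i =
    mv (\<lambda>r c. Ab S r c - mm Lb (pb S) (Cb S) r c) (nb S) (err_b S v) i"
  using assms
  by (simp add: err_b_def[abs_def] cl_rhs_def Let_def cat_def off_hb_def mv_diff[symmetric] mv_diff_mat mv_mm sub_def)

text \<open>The terms in y_0 and in H_dd y_d are measured and enter plant and observer identically,
  so they cancel. The unknown input remains, but only through \<open>Bd\<close>.\<close>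

lemma err_d_rhs:
  assumes S: "in_scb S" and i: "i < nd S"
  shows "err_d S (cl_rhs S Lb \<kappa> u0 ud t v) i =
    mv (Bd S) (md S) (\<lambda>k. mv (Fda S) (na S) (err_a S v) k + mv (Fdb S) (nb S) (err_b S v) k + ud t k
       + mv (Fdd S) (nd S) (err_d S v) k) i
    + mv (Jblk (qd S) (md S)) (nd S) (err_d S v) i
    - ld (qd S) (md S) \<kappa> (mv (Cd S) (nd S) (err_d S v)) i"
proof -
  have Ad: "mv (Ad S) (nd S) w i = mv (Jblk (qd S) (md S)) (nd S) w i + mv (Bd S) (md S) (mv (Fdd S) (nd S) w) i
      + mv (Hdd S) (md S) (mv (Cd S) (nd S) w) i" for w
  proof -
    have "mv (Ad S) (nd S) w i = mv (\<lambda>r c. Jblk (qd S) (md S) r c + mm (Bd S) (md S) (Fdd S) r c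
        + mm (Hdd S) (md S) (Cd S) r c) (nd S) w i"
      using S i unfolding mv_def in_scb_def by (intro sum.cong) auto
    then show ?thesis by (simp add: mv_add_mat mv_mm)
  qed
  have add: "mv A n (\<lambda>k. f k + g k) i = mv A n f i + mv A n g i" for A n f g
    by (simp add: mv_def distrib_left sum.distrib)
  have diff: "mv A n (\<lambda>k. f k - g k) j = mv A n f j - mv A n g j" for A n f g j
    by (simp add: mv_diff)
  show ?thesis
    using i unfolding err_d_def[abs_def] err_a_def[abs_def] err_b_def[abs_def] diff
    by (simp add: cl_rhs_def Let_def cat_def off_hd_def off_xd_def off_ha_def off_hb_def
        Ad add diff mv_add_mat mv_mm sub_def)
qed

section \<open>Indexing by block and position\<close>

lemma offs_Suc: "offs q (Suc i) = offs q i + q i"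
  by (simp add: offs_def)

lemma offs_mono: "i \<le> i' \<Longrightarrow> offs q i \<le> offs q i'"
  by (auto simp: offs_def intro: sum_mono2)

lemma block_unique:
  assumes "j < q i" "j' < q i'" "offs q i + j = offs q i' + j'"
  shows "i = i'" "j = j'"
proof -
  have "\<not> i < i'" using offs_mono[of "Suc i" i' q] assms by (auto simp: offs_Suc)
  moreover have "\<not> i' < i" using offs_mono[of "Suc i'" i q] assms by (auto simp: offs_Suc)
  ultimately show "i = i'" by simp
  then show "j = j'" using assms by simp
qed

lemma block_less:
  assumes "i < m" "j < q i"
  shows "offs q i + j < offs q m"
  using offs_mono[of "Suc i" m q] assms by (simp add: offs_Suc)

lemma block_exists:
  assumes "k < offs q m"
  shows "\<exists>i<m. \<exists>j<q i. k = offs q i + j"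
  using assms
proof (induction m)
  case (Suc m)
  show ?case
  proof (cases "k < offs q m")
    case True
    then show ?thesis using Suc.IH less_Suc_eq by blast
  next
    case False
    then show ?thesis using Suc.prems
      by (intro exI[of _ m] conjI exI[of _ "k - offs q m"]) (auto simp: offs_Suc)
  qed
qed (simp add: offs_def)

lemma mv_single:
  assumes "k < n" "\<And>c. c < n \<Longrightarrow> c \<noteq> k \<Longrightarrow> A r c = 0"
  shows "mv A n v r = A r k * v k"
proof -
  have "mv A n v r = (\<Sum>c\<in>{k}. A r c * v c)"
    unfolding mv_def by (rule sum.mono_neutral_right) (use assms in auto)
  then show ?thesis by simp
qed

lemma mv_zero_row:
  assumes "\<And>c. c < n \<Longrightarrow> A r c = 0"
  shows "mv A n v r = 0"
  unfolding mv_def by (rule sum.neutral) (use assms in auto)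

section \<open>Rows of the block matrices\<close>

context
  fixes S i j
  assumes S: "in_scb S" and i: "i < md S" and j: "j < qd S i"
begin

lemma scb_nd: "nd S = offs (qd S) (md S)"
  using S by (simp add: in_scb_def offs_def)

lemma scb_block_less: "offs (qd S) i + j < nd S"
  unfolding scb_nd by (rule block_less[where q="qd S", OF i j])

lemma mv_Bd_block: "mv (Bd S) (md S) g (offs (qd S) i + j) = (if Suc j = qd S i then g i else 0)"
proof -
  have B: "Bd S (offs (qd S) i + j) c = Bblk (qd S) (md S) (offs (qd S) i + j) c" if "c < md S" for c
    using S scb_block_less that unfolding in_scb_def by blast
  have eq: "offs (qd S) i + j = offs (qd S) c + (qd S c - 1) \<longleftrightarrow> c = i \<and> Suc j = qd S i" if "c < md S" for c
  proof -
    have "1 \<le> qd S c" using S that by (simp add: in_scb_def)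
    then show ?thesis using block_unique[of j "qd S" i "qd S c - 1" c] j by auto
  qed
  have "mv (Bd S) (md S) g (offs (qd S) i + j) = Bd S (offs (qd S) i + j) i * g i"
    by (rule mv_single[OF i]) (simp add: B Bblk_def eq del: One_nat_def)
  then show ?thesis using i eq[OF i] by (simp add: B Bblk_def del: One_nat_def)
qed

lemma mv_J_block: "mv (Jblk (qd S) (md S)) (nd S) e (offs (qd S) i + j) =
    (if Suc j < qd S i then e (offs (qd S) i + Suc j) else 0)"
proof -
  have eq: "(\<exists>i'<md S. \<exists>j'. Suc j' < qd S i' \<and> offs (qd S) i + j = offs (qd S) i' + j' \<and> c = Suc (offs (qd S) i + j))
     \<longleftrightarrow> Suc j < qd S i \<and> c = Suc (offs (qd S) i + j)" for c
    using block_unique[of j "qd S" i] j i by (metis Suc_lessD)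
  have J: "Jblk (qd S) (md S) (offs (qd S) i + j) c =
      (if Suc j < qd S i \<and> c = Suc (offs (qd S) i + j) then 1 else 0)" for c
    unfolding Jblk_def eq ..
  show ?thesis
  proof (cases "Suc j < qd S i")
    case True
    then have "Suc (offs (qd S) i + j) < nd S"
      unfolding scb_nd using block_less[OF i, of "Suc j" "qd S"] by simp
    then show ?thesis
      using True mv_single[of "Suc (offs (qd S) i + j)" "nd S" "Jblk (qd S) (md S)" "offs (qd S) i + j" e]
      by (simp add: J)
  next
    case False
    then show ?thesis by (simp add: J mv_zero_row)
  qed
qed

lemma ld_block: "ld (qd S) (md S) \<kappa> y (offs (qd S) i + j) =
    \<kappa> i j * spow (y i) (real (qd S i - Suc j) / real (qd S i))"
proof -
  have "ld (qd S) (md S) \<kappa> y (offs (qd S) i + j) = (\<Sum>i'<md S. \<Sum>j'<qd S i'.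
      if i' = i \<and> j' = j then \<kappa> i j * spow (y i) (real (qd S i - Suc j) / real (qd S i)) else 0)"
    unfolding ld_def
    by (intro sum.cong if_cong refl) (use block_unique[of j "qd S" i] j in auto)
  also have "\<dots> = (\<Sum>i'<md S. if i' = i then \<kappa> i j * spow (y i) (real (qd S i - Suc j) / real (qd S i)) else 0)"
    using j by (intro sum.cong) auto
  also have "\<dots> = \<kappa> i j * spow (y i) (real (qd S i - Suc j) / real (qd S i))" using i by simp
  finally show ?thesis .
qed

lemma mv_Cd_block: "mv (Cd S) (nd S) e i = e (offs (qd S) i)"
proof -
  have l: "offs (qd S) i < nd S" using scb_block_less by simp
  have C: "Cd S i c = Cblk (qd S) (md S) i c" if "c < nd S" for c
    using S i that unfolding in_scb_def by blast
  have "mv (Cd S) (nd S) e i = Cd S i (offs (qd S) i) * e (offs (qd S) i)"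
    by (rule mv_single[OF l]) (simp add: C Cblk_def)
  then show ?thesis using l i by (simp add: C Cblk_def)
qed

end

text \<open>All that enters the last equation of block \<open>i\<close> besides the injection; it
  becomes the disturbance \<open>x 0\<close> of the chain.\<close>

definition block_dist :: "scb_sys \<Rightarrow> (real \<Rightarrow> nat \<Rightarrow> real) \<Rightarrow> real \<Rightarrow> (nat \<Rightarrow> real) \<Rightarrow> nat \<Rightarrow> real" where
  "block_dist S ud t v i = mv (Fda S) (na S) (err_a S v) i + mv (Fdb S) (nb S) (err_b S v) i + ud t i
     + mv (Fdd S) (nd S) (err_d S v) i"

lemma err_d_rhs_block:
  assumes S: "in_scb S" and i: "i < md S" and j: "j < qd S i"
  shows "err_d S (cl_rhs S Lb \<kappa> u0 ud t v) (offs (qd S) i + j) =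
    (if Suc j = qd S i then block_dist S ud t v i else err_d S v (offs (qd S) i + Suc j))
    - \<kappa> i j * spow (err_d S v (offs (qd S) i)) (real (qd S i - Suc j) / real (qd S i))"
  using j
  by (auto simp: err_d_rhs[OF S scb_block_less[OF S i j]] mv_Bd_block[OF S i j] mv_J_block[OF S i j]
      ld_block[OF S i j] mv_Cd_block[OF S i j] block_dist_def)

lemma bounded_linear_dec: "bounded_linear (\<lambda>w. dec \<iota> w k)"
  unfolding dec_def by (rule bounded_linear_vec_nth)

lemma isCont_dec: "isCont (\<lambda>w. dec \<iota> w k) x"
  by (rule bounded_linear.isCont[OF bounded_linear_dec continuous_ident])

lemma isCont_mv:
  assumes "\<And>k. k < n \<Longrightarrow> isCont (\<lambda>w. v w k) x"
  shows "isCont (\<lambda>w. mv A n (v w) i) x"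
  unfolding mv_def using assms by (intro continuous_intros) auto

lemma isCont_errs:
  "isCont (\<lambda>w. err_a S (dec \<iota> w) k) x" "isCont (\<lambda>w. err_b S (dec \<iota> w) k) x"
  "isCont (\<lambda>w. err_d S (dec \<iota> w) k) x"
  unfolding err_a_def err_b_def err_d_def by (intro continuous_intros isCont_dec)+

lemma bounded_linear_errs:
  "bounded_linear (\<lambda>w. err_a S (dec \<iota> w) k)" "bounded_linear (\<lambda>w. err_b S (dec \<iota> w) k)"
  "bounded_linear (\<lambda>w. err_d S (dec \<iota> w) k)"
  unfolding err_a_def err_b_def err_d_def by (intro bounded_linear_sub bounded_linear_dec)+

lemma functional_has_real_derivative:
  fixes \<phi> :: "'a::real_normed_vector \<Rightarrow> real"
  assumes "bounded_linear \<phi>" "(z has_vector_derivative d) (at t)"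
  shows "((\<lambda>t. \<phi> (z t)) has_real_derivative \<phi> d) (at t)"
  using bounded_linear.has_vector_derivative[OF assms]
  by (simp add: has_real_derivative_iff_has_vector_derivative)

lemma spow_0: "spow x 0 = sgn x"
  by (simp add: spow_def)

lemma isCont_spow: "0 < a \<Longrightarrow> isCont f x \<Longrightarrow> isCont (\<lambda>w. spow (f w) a) x"
  unfolding isCont_def by (rule tendsto_spow)

section \<open>Velocities of the error components at a fixed time\<close>

context
  fixes S :: scb_sys and \<iota> :: "nat \<Rightarrow> 'n::finite" and Lb \<kappa> u0 ud t x d
  assumes S: "in_scb S" and coords: "bij_betw \<iota> {..<cl_dim S} (UNIV :: 'n set)"
    and d: "d \<in> filippov_set (\<lambda>w. enc \<iota> (cl_dim S) (cl_rhs S Lb \<kappa> u0 ud t (dec \<iota> w))) x"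
begin

lemma err_a_velocity:
  assumes i: "i < na S"
  shows "err_a S (dec \<iota> d) i = mv (Aa S) (na S) (err_a S (dec \<iota> x)) i"
proof (rule filippov_set_functional_eq[OF d bounded_linear_errs(1)])
  show "isCont (\<lambda>w. mv (Aa S) (na S) (err_a S (dec \<iota> w)) i) x"
    by (intro isCont_mv isCont_errs)
  have "err_a S (dec \<iota> (enc \<iota> (cl_dim S) v)) i = err_a S v i" for v
  proof -
    have "i < cl_dim S" "off_ha S + i < cl_dim S" using i by (simp_all add: off_ha_def cl_dim_def)
    then show ?thesis unfolding err_a_def by (simp add: dec_enc[OF coords])
  qed
  then show "\<forall>\<^sub>F w in nhds x. err_a S (dec \<iota> (enc \<iota> (cl_dim S) (cl_rhs S Lb \<kappa> u0 ud t (dec \<iota> w)))) i =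
      mv (Aa S) (na S) (err_a S (dec \<iota> w)) i"
    by (simp add: err_a_rhs[OF i])
qed

lemma err_b_velocity:
  assumes i: "i < nb S"
  shows "err_b S (dec \<iota> d) i =
    mv (\<lambda>r c. Ab S r c - mm Lb (pb S) (Cb S) r c) (nb S) (err_b S (dec \<iota> x)) i"
proof (rule filippov_set_functional_eq[OF d bounded_linear_errs(2)])
  show "isCont (\<lambda>w. mv (\<lambda>r c. Ab S r c - mm Lb (pb S) (Cb S) r c) (nb S) (err_b S (dec \<iota> w)) i) x"
    by (intro isCont_mv isCont_errs)
  have "err_b S (dec \<iota> (enc \<iota> (cl_dim S) v)) i = err_b S v i" for v
  proof -
    have "na S + i < cl_dim S" "off_hb S + i < cl_dim S" using i by (simp_all add: off_hb_def cl_dim_def)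
    then show ?thesis unfolding err_b_def by (simp add: dec_enc[OF coords])
  qed
  then show "\<forall>\<^sub>F w in nhds x. err_b S (dec \<iota> (enc \<iota> (cl_dim S) (cl_rhs S Lb \<kappa> u0 ud t (dec \<iota> w)))) i =
      mv (\<lambda>r c. Ab S r c - mm Lb (pb S) (Cb S) r c) (nb S) (err_b S (dec \<iota> w)) i"
    by (simp add: err_b_rhs[OF i])
qed

lemma err_d_dec_enc:
  assumes "k < nd S"
  shows "err_d S (dec \<iota> (enc \<iota> (cl_dim S) v)) k = err_d S v k"
proof -
  have "off_xd S + k < cl_dim S" "off_hd S + k < cl_dim S"
    using assms by (simp_all add: off_xd_def off_hd_def cl_dim_def)
  then show ?thesis unfolding err_d_def by (simp add: dec_enc[OF coords])
qed

text \<open>Above the last row of a block the injection exponent is positive, so the right-hand side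
  is continuous and the Filippov velocity is exact.\<close>

lemma err_d_velocity:
  assumes i: "i < md S" and j: "Suc j < qd S i"
  shows "err_d S (dec \<iota> d) (offs (qd S) i + j) = err_d S (dec \<iota> x) (offs (qd S) i + Suc j)
    - \<kappa> i j * spow (err_d S (dec \<iota> x) (offs (qd S) i)) (real (qd S i - Suc j) / real (qd S i))"
proof (rule filippov_set_functional_eq[OF d bounded_linear_errs(3)])
  show "isCont (\<lambda>w. err_d S (dec \<iota> w) (offs (qd S) i + Suc j)
    - \<kappa> i j * spow (err_d S (dec \<iota> w) (offs (qd S) i)) (real (qd S i - Suc j) / real (qd S i))) x"
    using j by (intro continuous_intros isCont_spow isCont_errs) auto
  have j': "j < qd S i" using j by simp
  show "\<forall>\<^sub>F w in nhds x. err_d S (dec \<iota> (enc \<iota> (cl_dim S) (cl_rhs S Lb \<kappa> u0 ud t (dec \<iota> w)))) (offs (qd S) i + j) =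
      err_d S (dec \<iota> w) (offs (qd S) i + Suc j)
    - \<kappa> i j * spow (err_d S (dec \<iota> w) (offs (qd S) i)) (real (qd S i - Suc j) / real (qd S i))"
    using j unfolding err_d_dec_enc[OF scb_block_less[OF S i j']] err_d_rhs_block[OF S i j'] by simp
qed

text \<open>In the last row the exponent is 0: this is the only row of the block with a jump, and it
  provides the selection \<open>s\<close>.\<close>

lemma err_d_last_velocity:
  assumes i: "i < md S" and \<kappa>: "0 < \<kappa> i (qd S i - 1)"
  shows "\<exists>s. \<bar>s\<bar> \<le> 1 \<and>
    s * err_d S (dec \<iota> x) (offs (qd S) i) = \<bar>err_d S (dec \<iota> x) (offs (qd S) i)\<bar> \<and>
    err_d S (dec \<iota> d) (offs (qd S) i + (qd S i - 1)) =
      block_dist S ud t (dec \<iota> x) i - \<kappa> i (qd S i - 1) * s"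
proof -
  have q: "1 \<le> qd S i" using S i by (simp add: in_scb_def)
  then have j': "qd S i - 1 < qd S i" by simp
  have eq: "err_d S (dec \<iota> (enc \<iota> (cl_dim S) (cl_rhs S Lb \<kappa> u0 ud t (dec \<iota> w)))) (offs (qd S) i + (qd S i - 1)) =
      block_dist S ud t (dec \<iota> w) i - \<kappa> i (qd S i - 1) * sgn (err_d S (dec \<iota> w) (offs (qd S) i))" for w
    using q unfolding err_d_dec_enc[OF scb_block_less[OF S i j']] err_d_rhs_block[OF S i j']
    by (simp add: spow_0)
  have cont: "isCont (\<lambda>w. block_dist S ud t (dec \<iota> w) i) x"
    unfolding block_dist_def by (intro continuous_intros isCont_mv isCont_errs)
  show ?thesis
    by (rule filippov_set_functional_sgn[OF d bounded_linear_errs(3) cont isCont_errs(3) \<kappa> eq]) blast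
qed

end

theorem theorem2:
  fixes S :: scb_sys
    and Lb :: "nat \<Rightarrow> nat \<Rightarrow> real"
    and \<Delta> :: "nat \<Rightarrow> real"
    and \<iota> :: "nat \<Rightarrow> 'n::finite"
  assumes scb: "in_scb S"
    and Fdd: "Fdd_structured S"
    and detect: "hurwitz (na S) (Aa S)"
    and Lb: "hurwitz (nb S) (\<lambda>r c. Ab S r c - mm Lb (pb S) (Cb S) r c)"
    and Delta: "\<forall>i<md S. 0 \<le> \<Delta> i"
    and coords: "bij_betw \<iota> {..<cl_dim S} (UNIV :: 'n set)"
  shows "\<exists>\<kappa> :: nat \<Rightarrow> nat \<Rightarrow> real.
           (\<forall>i<md S. \<forall>j<qd S i. 0 < \<kappa> i j) \<and>
           (\<forall>(u0 :: real \<Rightarrow> nat \<Rightarrow> real) (ud :: real \<Rightarrow> nat \<Rightarrow> real) (z :: real \<Rightarrow> real^'n).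
              (\<forall>k. (\<lambda>t. u0 t k) \<in> borel_measurable lborel) \<and>
              (\<forall>k. (\<lambda>t. ud t k) \<in> borel_measurable lborel) \<and>
              (\<forall>t\<ge>0. \<forall>i<md S. \<bar>ud t i\<bar> \<le> \<Delta> i) \<and>
              filippov_solution (\<lambda>t w. enc \<iota> (cl_dim S) (cl_rhs S Lb \<kappa> u0 ud t (dec \<iota> w))) z
              \<longrightarrow> (\<exists>Tf. \<forall>t\<ge>Tf. \<forall>k<nd S.
                     dec \<iota> (z t) (off_xd S + k) - dec \<iota> (z t) (off_hd S + k) = 0))"
proof -
  have q: "1 \<le> qd S i" if "i < md S" for i using scb that by (simp add: in_scb_def)
  \<comment> \<open>The surplus 1 is reserved for the couplings with \<open>err_a\<close> and
    \<open>err_b\<close>, which eventually stay below it.\<close>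
  have "\<exists>c. i < md S \<longrightarrow> finite_time_gains (qd S i) (\<Delta> i + 1) c" for i
    using finite_time_gains_exist[of "qd S i" "\<Delta> i + 1"] q[of i] Delta by fastforce
  then obtain c where c: "\<And>i. i < md S \<Longrightarrow> finite_time_gains (qd S i) (\<Delta> i + 1) (c i)" by metis
  \<comment> \<open>Blocks are numbered from the top starting with 0, chains from the bottom
    starting with 1; position \<open>j\<close> is therefore chain index
    \<open>qd S i - j\<close>.\<close>
  define \<kappa> where "\<kappa> i j = c i (qd S i - j)" for i j
  have \<kappa>: "0 < \<kappa> i j" if "i < md S" "j < qd S i" for i j
    using c[OF that(1)] that(2) unfolding finite_time_gains_def \<kappa>_def by auto
  show ?thesis
  proof (intro exI[of _ \<kappa>] conjI allI impI)
    fix u0 ud :: "real \<Rightarrow> nat \<Rightarrow> real" and z :: "real \<Rightarrow> real^'n"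
    assume H: "(\<forall>k. (\<lambda>t. u0 t k) \<in> borel_measurable lborel) \<and>
      (\<forall>k. (\<lambda>t. ud t k) \<in> borel_measurable lborel) \<and>
      (\<forall>t\<ge>0. \<forall>i<md S. \<bar>ud t i\<bar> \<le> \<Delta> i) \<and>
      filippov_solution (\<lambda>t w. enc \<iota> (cl_dim S) (cl_rhs S Lb \<kappa> u0 ud t (dec \<iota> w))) z"
    then have ud: "\<And>t i. t \<ge> 0 \<Longrightarrow> i < md S \<Longrightarrow> \<bar>ud t i\<bar> \<le> \<Delta> i"
      and sol: "filippov_solution (\<lambda>t w. enc \<iota> (cl_dim S) (cl_rhs S Lb \<kappa> u0 ud t (dec \<iota> w))) z"
      by blast+
    have ac: "\<And>T. T \<ge> 0 \<Longrightarrow> abs_cont_on 0 T z"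
      and ae: "AE t in lborel. 0 < t \<longrightarrow> (\<exists>d. (z has_vector_derivative d) (at t) \<and>
        d \<in> filippov_set (\<lambda>w. enc \<iota> (cl_dim S) (cl_rhs S Lb \<kappa> u0 ud t (dec \<iota> w))) (z t))"
      using sol unfolding filippov_solution_def by blast+
    obtain M where M0: "{t \<in> space lborel. \<not> (0 < t \<longrightarrow> (\<exists>d. (z has_vector_derivative d) (at t) \<and>
        d \<in> filippov_set (\<lambda>w. enc \<iota> (cl_dim S) (cl_rhs S Lb \<kappa> u0 ud t (dec \<iota> w))) (z t)))} \<subseteq> M"
      and "M \<in> null_sets lborel"
      using ae unfolding eventually_ae_filter by blast
    then have M: "negligible M" by (simp add: negligible_iff_null_sets null_sets_completionI)
    have der: "\<exists>d. (z has_vector_derivative d) (at t) \<and>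
        d \<in> filippov_set (\<lambda>w. enc \<iota> (cl_dim S) (cl_rhs S Lb \<kappa> u0 ud t (dec \<iota> w))) (z t)"
      if "0 < t" "t \<notin> M" for t
      using M0 that by auto
    define ea where "ea t = err_a S (dec \<iota> (z t))" for t
    define eb where "eb t = err_b S (dec \<iota> (z t))" for t
    define ed where "ed t = err_d S (dec \<iota> (z t))" for t
    have ea0: "((\<lambda>t. ea t i) \<longlongrightarrow> 0) at_top" if "i < na S" for i
    proof (rule hurwitz_tendsto_0[OF detect _ M _ that])
      show "abs_cont_on 0 T (\<lambda>t. ea t i)" if "T \<ge> 0" for i T
        unfolding ea_def by (rule abs_cont_on_bounded_linear[OF ac[OF that] bounded_linear_errs(1)])
      fix t i assume t: "0 < t" "t \<notin> M" and i: "i < na S"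
      obtain d where "(z has_vector_derivative d) (at t)" and
        d: "d \<in> filippov_set (\<lambda>w. enc \<iota> (cl_dim S) (cl_rhs S Lb \<kappa> u0 ud t (dec \<iota> w))) (z t)"
        using der[OF t] by blast
      then show "((\<lambda>t. ea t i) has_real_derivative (\<Sum>j<na S. Aa S i j * ea t j)) (at t)"
        using functional_has_real_derivative[OF bounded_linear_errs(1)] err_a_velocity[OF scb coords d i]
        unfolding ea_def mv_def by metis
    qed
    have eb0: "((\<lambda>t. eb t i) \<longlongrightarrow> 0) at_top" if "i < nb S" for i
    proof (rule hurwitz_tendsto_0[OF Lb _ M _ that])
      show "abs_cont_on 0 T (\<lambda>t. eb t i)" if "T \<ge> 0" for i T
        unfolding eb_def by (rule abs_cont_on_bounded_linear[OF ac[OF that] bounded_linear_errs(2)])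
      fix t i assume t: "0 < t" "t \<notin> M" and i: "i < nb S"
      obtain d where "(z has_vector_derivative d) (at t)" and
        d: "d \<in> filippov_set (\<lambda>w. enc \<iota> (cl_dim S) (cl_rhs S Lb \<kappa> u0 ud t (dec \<iota> w))) (z t)"
        using der[OF t] by blast
      then show "((\<lambda>t. eb t i) has_real_derivative
          (\<Sum>j<nb S. (Ab S i j - mm Lb (pb S) (Cb S) i j) * eb t j)) (at t)"
        using functional_has_real_derivative[OF bounded_linear_errs(2)] err_b_velocity[OF scb coords d i]
        unfolding eb_def mv_def by metis
    qed
    have small: "\<forall>\<^sub>F t in at_top. \<bar>mv (Fda S) (na S) (ea t) i + mv (Fdb S) (nb S) (eb t) i\<bar> < 1" for i
    proof -
      have "((\<lambda>t. \<bar>mv (Fda S) (na S) (ea t) i + mv (Fdb S) (nb S) (eb t) i\<bar>) \<longlongrightarrow>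
          \<bar>(\<Sum>j<na S. Fda S i j * 0) + (\<Sum>j<nb S. Fdb S i j * 0)\<bar>) at_top"
        unfolding mv_def
        by (intro tendsto_rabs tendsto_add tendsto_sum tendsto_mult tendsto_const ea0 eb0) auto
      then show ?thesis by (rule order_tendstoD) simp
    qed
    \<comment> \<open>Stating the claim with an eventuality merges the finitely many settling times
      of the earlier blocks.\<close>
    have block: "\<forall>\<^sub>F t in at_top. \<forall>j<qd S i. ed t (offs (qd S) i + j) = 0" if "i < md S" for i
      using that
    proof (induction i rule: less_induct)
      case (less i)
      note i = less.prems
      define n where "n = qd S i"
      have n: "1 \<le> n" using q[OF i] by (simp add: n_def)
      have "\<forall>\<^sub>F t in at_top. \<forall>b\<in>{..<i}. \<forall>j<qd S b. ed t (offs (qd S) b + j) = 0"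
        using less by (intro eventually_ball_finite) auto
      with small[of i] have "\<forall>\<^sub>F t in at_top. \<bar>mv (Fda S) (na S) (ea t) i + mv (Fdb S) (nb S) (eb t) i\<bar> < 1 \<and>
          (\<forall>b\<in>{..<i}. \<forall>j<qd S b. ed t (offs (qd S) b + j) = 0)"
        by (rule eventually_conj)
      then obtain T1 where T1: "\<And>t. t \<ge> T1 \<Longrightarrow> \<bar>mv (Fda S) (na S) (ea t) i + mv (Fdb S) (nb S) (eb t) i\<bar> < 1 \<and>
          (\<forall>b\<in>{..<i}. \<forall>j<qd S b. ed t (offs (qd S) b + j) = 0)"
        unfolding eventually_at_top_linorder by blast
      define T0 where "T0 = max T1 0"
      \<comment> \<open>The block read from the bottom: \<open>x t n\<close> is the measured error
        and \<open>x t 1\<close> the last row. Slot 0 holds the disturbance, for which only a bound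
        is available and no continuity.\<close>
      define x where "x t k = (if k = 0 then block_dist S ud t (dec \<iota> (z t)) i
          else ed t (offs (qd S) i + (n - k)))" for t k
      \<comment> \<open>One \<open>s\<close> must serve all \<open>k\<close> at the same time
        \<open>t\<close>; it is taken from the last row, the other rows being independent of
        it.\<close>
      have "\<exists>s. \<bar>s\<bar> \<le> 1 \<and> s * x t n = \<bar>x t n\<bar> \<and> (\<forall>k\<in>{1..n}.
          ((\<lambda>t. x t k) has_real_derivative diff_vel (c i) n (x t) (x t n) s k) (at t))"
        if t: "0 < t" "t \<notin> M" for t
      proof -
        obtain d where zd: "(z has_vector_derivative d) (at t)" and
          d: "d \<in> filippov_set (\<lambda>w. enc \<iota> (cl_dim S) (cl_rhs S Lb \<kappa> u0 ud t (dec \<iota> w))) (z t)"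
          using der[OF t] by blast
        have xn: "x t n = err_d S (dec \<iota> (z t)) (offs (qd S) i)" using n by (simp add: x_def ed_def)
        have "0 < \<kappa> i (qd S i - 1)" using q[OF i] by (intro \<kappa> i) simp
        from err_d_last_velocity[OF scb coords d i this]
        obtain s where s: "\<bar>s\<bar> \<le> 1"
            "s * err_d S (dec \<iota> (z t)) (offs (qd S) i) = \<bar>err_d S (dec \<iota> (z t)) (offs (qd S) i)\<bar>"
          and last: "err_d S (dec \<iota> d) (offs (qd S) i + (qd S i - 1)) =
            block_dist S ud t (dec \<iota> (z t)) i - \<kappa> i (qd S i - 1) * s"
          by (elim exE conjE)
        have "((\<lambda>t. x t k) has_real_derivative diff_vel (c i) n (x t) (x t n) s k) (at t)" if k: "k \<in> {1..n}" for k
        proof -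
          have "((\<lambda>t. x t k) has_real_derivative err_d S (dec \<iota> d) (offs (qd S) i + (n - k))) (at t)"
            using functional_has_real_derivative[OF bounded_linear_errs(3) zd] k
            by (simp add: x_def ed_def)
          also have "err_d S (dec \<iota> d) (offs (qd S) i + (n - k)) = diff_vel (c i) n (x t) (x t n) s k"
          proof (cases "k = 1")
            case True
            then show ?thesis using last n by (simp add: diff_vel_def x_def \<kappa>_def n_def)
          next
            case False
            then have "Suc (n - k) < qd S i" "Suc (n - k) = n - (k - 1)" "n - (n - (k - 1)) = k - 1"
              using k by (auto simp: n_def)
            moreover have "\<kappa> i (n - k) = c i k" using k by (simp add: \<kappa>_def n_def)
            ultimately show ?thesis
              using False k err_d_velocity[OF scb coords d i, of "n - k"]
              by (simp add: diff_vel_def xn x_def ed_def n_def del: of_nat_diff)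
          qed
          finally show ?thesis .
        qed
        with s show ?thesis unfolding xn by blast
      qed
      then obtain s where s: "\<And>t. 0 < t \<Longrightarrow> t \<notin> M \<Longrightarrow> \<bar>s t\<bar> \<le> 1 \<and> s t * x t n = \<bar>x t n\<bar> \<and>
          (\<forall>k\<in>{1..n}. ((\<lambda>t. x t k) has_real_derivative diff_vel (c i) n (x t) (x t n) (s t) k) (at t))"
        by metis
      have acx: "abs_cont_on T0 T (\<lambda>t. x t k)" if "k \<in> {1..n}" "T \<ge> T0" for k T
      proof -
        have "abs_cont_on 0 T (\<lambda>t. ed t (offs (qd S) i + (n - k)))"
          unfolding ed_def
          by (rule abs_cont_on_bounded_linear[OF ac bounded_linear_errs(3)]) (use that in \<open>simp add: T0_def\<close>)
        then have "abs_cont_on T0 T (\<lambda>t. ed t (offs (qd S) i + (n - k)))"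
          by (rule abs_cont_on_subset) (auto simp: T0_def)
        then show ?thesis using that by (simp add: x_def)
      qed
      have dist: "\<bar>x t 0\<bar> \<le> \<Delta> i + 1" if t: "t > T0" for t
      proof -
        \<comment> \<open>Columns in blocks before \<open>i\<close> meet errors that have already
          vanished; in the remaining blocks the entries of row \<open>i\<close> are 0 by the
          structure of \<open>Fdd\<close>.\<close>
        have F: "mv (Fdd S) (nd S) (ed t) i = 0"
          unfolding mv_def
        proof (rule sum.neutral, rule ballI)
          fix k assume "k \<in> {..<nd S}"
          then have "k < offs (qd S) (md S)" using scb by (simp add: in_scb_def offs_def)
          then obtain b j where b: "b < md S" "j < qd S b" "k = offs (qd S) b + j"
            using block_exists by blast
          show "Fdd S i k * ed t k = 0"
          proof (cases "b < i")
            case True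
            then show ?thesis using T1[of t] t b by (simp add: T0_def)
          next
            case False
            then show ?thesis using Fdd i b unfolding Fdd_structured_def by simp
          qed
        qed
        have "x t 0 = (mv (Fda S) (na S) (ea t) i + mv (Fdb S) (nb S) (eb t) i) + ud t i"
          using F by (simp add: x_def block_dist_def ea_def eb_def ed_def)
        moreover have "\<bar>ud t i\<bar> \<le> \<Delta> i" using t i by (intro ud) (simp_all add: T0_def)
        moreover have "\<bar>mv (Fda S) (na S) (ea t) i + mv (Fdb S) (nb S) (eb t) i\<bar> < 1"
          using T1[of t] t by (simp add: T0_def)
        ultimately show ?thesis by linarith
      qed
      have "\<exists>Tf. \<forall>t\<ge>Tf. \<forall>k\<in>{1..n}. x t k = 0"
      proof (rule c[OF i, folded n_def, unfolded finite_time_gains_def, THEN conjunct2, rule_format, OF M])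
        show "abs_cont_on T0 T (\<lambda>t. x t k)" if "k \<in> {1..n}" "T \<ge> T0" for k T
          using acx that by blast
        fix t assume "T0 < t" "t \<notin> M"
        then show "\<bar>x t 0\<bar> \<le> \<Delta> i + 1 \<and> \<bar>s t\<bar> \<le> 1 \<and> s t * x t n = \<bar>x t n\<bar> \<and>
          (\<forall>k\<in>{1..n}. ((\<lambda>t. x t k) has_real_derivative diff_vel (c i) n (x t) (x t n) (s t) k) (at t))"
          using s[of t] dist[of t] by (simp add: T0_def)
      qed
      then obtain Tf where Tf: "\<And>t k. t \<ge> Tf \<Longrightarrow> k \<in> {1..n} \<Longrightarrow> x t k = 0" by blast
      show ?case
        unfolding eventually_at_top_linorder
      proof (intro exI[of _ Tf] allI impI)
        fix t j assume t: "Tf \<le> t" and j: "j < qd S i"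
        show "ed t (offs (qd S) i + j) = 0"
          using Tf[OF t, of "n - j"] j by (simp add: x_def n_def)
      qed
    qed
    have "\<forall>\<^sub>F t in at_top. \<forall>i\<in>{..<md S}. \<forall>j<qd S i. ed t (offs (qd S) i + j) = 0"
      using block by (intro eventually_ball_finite) auto
    then obtain Tf where Tf: "\<And>t i j. t \<ge> Tf \<Longrightarrow> i < md S \<Longrightarrow> j < qd S i \<Longrightarrow> ed t (offs (qd S) i + j) = 0"
      unfolding eventually_at_top_linorder by blast
    show "\<exists>Tf. \<forall>t\<ge>Tf. \<forall>k<nd S. dec \<iota> (z t) (off_xd S + k) - dec \<iota> (z t) (off_hd S + k) = 0"
    proof (intro exI[of _ Tf] allI impI)
      fix t k assume t: "Tf \<le> t" and k: "k < nd S"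
      then have "k < offs (qd S) (md S)" using scb by (simp add: in_scb_def offs_def)
      then obtain i j where "i < md S" "j < qd S i" "k = offs (qd S) i + j"
        using block_exists by blast
      then have "ed t k = 0" using Tf[OF t] by simp
      then show "dec \<iota> (z t) (off_xd S + k) - dec \<iota> (z t) (off_hd S + k) = 0"
        by (simp add: ed_def err_d_def)
    qed
  qed (use \<kappa> in blast)
qed

end
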